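(* Let $A$ be a finite subset of $\mathbb{Q}$ such that $|A\cdot A|\le K|A|$ for some $K\ge1$, let $\varphi\in\mathbb{Q}[x]$ have $\deg\varphi=d\ge1$ with $\varphi(0)\ne0$, and let $\varepsilon>0$. Then \[ \#\{(a_1,a_2)\in A^2: a_1=\varphi(a_2)\}\ll_{d,\varepsilon}K^C|A|^\varepsilon \] for some constant $C=C(d,\varepsilon)>0$.
   Context: $A\cdot A=\{a_1a_2:a_1,a_2\in A\}$. $X\ll_z Y$ means $|X|\le C_zY$ for a positive constant $C_z$ depending only on $z$. *)

theory Defs
  imports
    Complex_Main
    "HOL-Library.Set_Algebras"
    "HOL-Computational_Algebra.Polynomial"
begin

end

theory Submission
  imports
    Defs
    "HOL-Library.Poly_Mapping"
    "HOL-Library.Product_Plus"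
    "HOL-Analysis.Convex"
    "HOL-Computational_Algebra.Squarefree"
begin

text \<open>
  Put \<open>g a = (a, \<phi> a)\<close>. If \<open>A'\<close> is the set of \<open>a \<in> A\<close> with \<open>\<phi> a \<in> A\<close>, then \<open>g ` A' \<subseteq> A \<times> A\<close>, so by
  Pluennecke's inequality the \<open>q\<close>-fold product set of \<open>g ` A'\<close> has at most \<open>K ^ (2 * q) * card A ^ 2\<close>
  elements. It is therefore enough to show that, on a large part of \<open>A'\<close>, the \<open>q\<close>-fold multiplicative
  energy of \<open>g\<close> is nearly minimal, and to let \<open>q\<close> be large.

  Fix a prime \<open>p\<close>. Apart from boundedly many values of the valuation of \<open>a\<close>, some monomial of \<open>\<phi>\<close>
  dominates and \<open>\<phi> a = c * a ^ k * (1 + t)\<close>, where the valuation of \<open>t\<close> is positive and injective in that of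
  \<open>a\<close>. Hence in a relation between \<open>q\<close>-fold products of values of \<open>g\<close> the smallest valuation of \<open>t\<close> occurs twice, and the
  \<open>2 * q\<close>-norms of the fibres over the valuation are orthogonal up to a constant \<open>1 / \<theta>\<close> depending on the
  degree and \<open>q\<close> only. Splitting repeatedly along primes gives weights on \<open>A\<close> for which the energy of
  every polynomial graph is controlled; the largest total weight is the capacity of \<open>A\<close>. A set that splits
  along many primes has a large sumset in the free abelian group of positive rationals, and this yields
  that the capacity of \<open>A\<close> is at least \<open>card A / K ^ O(1)\<close>. The control is invariant
  under dilation because all polynomials are treated at once, so some dilate of the weights meets
  \<open>A'\<close> in a proportion \<open>1 / K ^ O(1)\<close>.
\<close>

subsection \<open>Sumsets\<close>

lemma card_translate: "card ((\<lambda>x. x + c) ` X) = card (X :: 'a::ab_group_add set)"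
  by (rule card_image) (auto simp: inj_on_def)

text \<open>Petridis's induction on \<open>C\<close>: passing to \<open>insert c C\<close> adds to
  \<open>X + A + C\<close> only translates by \<open>c\<close> of points of \<open>X + A\<close>
  outside \<open>Z + A\<close>, and minimality of the ratio \<open>\<kappa>\<close> at
  \<open>Z\<close> bounds their number by \<open>\<kappa>\<close> times
  \<open>card X - card Z\<close>.\<close>

lemma card_plus_minimal_ratio_le:
  fixes A X C :: "'a::ab_group_add set"
  assumes fin: "finite A" "finite X" "finite C" and \<kappa>: "real (card (X + A)) = \<kappa> * real (card X)"
    and min: "\<And>Z. Z \<subseteq> X \<Longrightarrow> \<kappa> * real (card Z) \<le> real (card (Z + A))"
    and \<kappa>0: "\<kappa> \<ge> 0"
  shows "real (card (X + A + C)) \<le> \<kappa> * real (card (X + C))"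
  using fin(3)
proof (induction C)
  case empty
  then show ?case by simp
next
  case (insert c C)
  define Z where "Z = {x \<in> X. (\<lambda>y. y + c) ` ({x} + A) \<subseteq> X + A + C}"
  \<comment> \<open>Exactly the points of \<open>X - W\<close> give new elements of
    \<open>X + insert c C\<close>. Since \<open>W \<subseteq> Z\<close>, these number at least
    \<open>card X - card Z\<close>, which pays for the growth on the left.\<close>
  define W where "W = {x \<in> X. x + c \<in> X + C}"
  have WZ: "W \<subseteq> Z"
  proof
    fix x assume x: "x \<in> W"
    then obtain x' c' where xc: "x + c = x' + c'" "x' \<in> X" "c' \<in> C"
      by (auto simp: W_def elim: set_plus_elim)
    have "(\<lambda>y. y + c) ` ({x} + A) \<subseteq> X + A + C"
    proof
      fix y assume "y \<in> (\<lambda>y. y + c) ` ({x} + A)"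
      then obtain a where a: "a \<in> A" "y = x + a + c" by (auto elim!: set_plus_elim)
      then have "y = (x' + a) + c'" using xc(1) by (metis add.assoc add.commute)
      then show "y \<in> X + A + C"
        using set_plus_intro[OF set_plus_intro[OF xc(2) a(1)] xc(3)] by simp
    qed
    then show "x \<in> Z" using x by (auto simp: Z_def W_def)
  qed
  have ZX: "Z \<subseteq> X" by (auto simp: Z_def)
  have finZ: "finite Z" "finite W"
    using finite_subset[OF ZX fin(2)] finite_subset[OF order_trans[OF WZ ZX] fin(2)] .
  have ZA: "(\<lambda>y. y + c) ` (Z + A) \<subseteq> X + A + C"
  proof
    fix y assume "y \<in> (\<lambda>y. y + c) ` (Z + A)"
    then obtain x a where xa: "x \<in> Z" "a \<in> A" "y = x + a + c" by (auto elim!: set_plus_elim)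
    then have "y \<in> (\<lambda>y. y + c) ` ({x} + A)" by auto
    then show "y \<in> X + A + C" using xa(1) by (auto simp: Z_def)
  qed
  have "X + A + insert c C \<subseteq> (X + A + C) \<union> (\<lambda>y. y + c) ` (X + A - (Z + A))"
  proof
    fix y assume "y \<in> X + A + insert c C"
    then obtain u v where uv: "u \<in> X + A" "v \<in> insert c C" "y = u + v"
      by (meson set_plus_elim)
    show "y \<in> (X + A + C) \<union> (\<lambda>y. y + c) ` (X + A - (Z + A))"
    proof (cases "v = c \<and> u \<notin> Z + A")
      case True
      then show ?thesis using uv by auto
    next
      case False
      then show ?thesis using uv ZA by auto
    qed
  qed
  then have "card (X + A + insert c C) \<le> card (X + A + C) + card ((\<lambda>y. y + c) ` (X + A - (Z + A)))"
    by (rule order_trans[OF card_mono card_Un_le, rotated])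
      (intro finite_UnI finite_imageI finite_Diff finite_set_plus fin insert.hyps(1))
  also have "\<dots> = card (X + A + C) + (card (X + A) - card (Z + A))"
    unfolding card_translate
    by (subst card_Diff_subset[OF finite_set_plus[OF finZ(1) fin(1)] set_plus_mono2[OF ZX order_refl]])
      (rule refl)
  finally have "real (card (X + A + insert c C)) \<le>
      real (card (X + A + C)) + (real (card (X + A)) - real (card (Z + A)))"
    using card_mono[OF finite_set_plus[OF fin(2,1)] set_plus_mono2[OF ZX order_refl]] by linarith
  also have "\<dots> \<le> \<kappa> * real (card (X + C)) + (\<kappa> * real (card X) - \<kappa> * real (card Z))"
    using insert.IH min[OF ZX] \<kappa> by linarith
  also have "\<dots> = \<kappa> * (real (card (X + C)) + real (card X) - real (card Z))"
    by (simp add: algebra_simps)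
  also have "\<dots> \<le> \<kappa> * real (card (X + insert c C))"
  proof (rule mult_left_mono[OF _ \<kappa>0])
    have "(X + C) \<union> (\<lambda>y. y + c) ` (X - W) \<subseteq> X + insert c C"
      using set_plus_mono2[OF order_refl[of X] subset_insertI[of C c]] by auto
    moreover have "(X + C) \<inter> (\<lambda>y. y + c) ` (X - W) = {}" by (auto simp: W_def)
    moreover have "finite (X + C)" "finite ((\<lambda>y. y + c) ` (X - W))" "finite (X + insert c C)"
      using fin(2) insert.hyps(1) by (auto intro: finite_set_plus)
    ultimately have "card (X + C) + card (X - W) \<le> card (X + insert c C)"
      using card_Un_disjoint[of "X + C" "(\<lambda>y. y + c) ` (X - W)"] card_translate[of c "X - W"]
        card_mono[of "X + insert c C" "(X + C) \<union> (\<lambda>y. y + c) ` (X - W)"]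
      by simp
    moreover have "card (X - W) = card X - card W" "card W \<le> card X"
      using finZ WZ ZX fin(2) by (auto simp: card_Diff_subset intro!: card_mono)
    moreover have "card W \<le> card Z" using WZ finZ by (simp add: card_mono)
    ultimately show "real (card (X + C)) + real (card X) - real (card Z) \<le>
        real (card (X + insert c C))"
      by linarith
  qed
  finally show ?case .
qed

fun fold_sumset :: "nat \<Rightarrow> 'a::ab_group_add set \<Rightarrow> 'a set" where
  "fold_sumset 0 A = {0}"
| "fold_sumset (Suc n) A = A + fold_sumset n A"

lemma finite_fold_sumset: "finite A \<Longrightarrow> finite (fold_sumset n A)"
  by (induction n) (auto intro: finite_set_plus)

lemma card_le_card_plus:
  fixes X Y :: "'a::ab_group_add set"
  assumes "finite X" "finite Y" "X \<noteq> {}"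
  shows "card Y \<le> card (X + Y)"
proof -
  obtain x where "x \<in> X" using assms by blast
  then have "(\<lambda>y. y + x) ` Y \<subseteq> X + Y" by (auto simp: add.commute[of _ x])
  then show ?thesis using card_mono[OF finite_set_plus[OF assms(1,2)]] card_translate[of x Y] by metis
qed

text \<open>Choose a nonempty \<open>X \<subseteq> A\<close> that minimises the ratio of
  \<open>card (X + A)\<close> to \<open>card X\<close>. The set \<open>A\<close> itself competes, so
  the minimum is at most \<open>K\<close>, and Petridis's inequality with
  \<open>C = fold_sumset n A\<close> costs one such factor per summand.\<close>

lemma card_fold_sumset_le:
  fixes A :: "'a::ab_group_add set"
  assumes fin: "finite A" and K: "real (card (A + A)) \<le> K * real (card A)" and ne: "A \<noteq> {}"
  shows "real (card (fold_sumset n A)) \<le> K ^ n * real (card A)"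
proof -
  define r where "r = (\<lambda>Z. real (card (Z + A)) / real (card Z))"
  let ?P = "Pow A - {{}}"
  have P: "finite ?P" "?P \<noteq> {}" using fin ne by auto
  define X where "X = arg_min_on r ?P"
  have X: "X \<in> ?P" and min: "\<And>Z. Z \<in> ?P \<Longrightarrow> r X \<le> r Z"
    using arg_min_if_finite[OF P, of r] unfolding X_def by (blast, meson not_less)
  have XA: "X \<subseteq> A" "X \<noteq> {}" "finite X" using X fin finite_subset by auto
  have cX: "card X > 0" using XA by (simp add: card_gt_0_iff)
  have cA: "card A > 0" using fin ne by (simp add: card_gt_0_iff)
  have r0: "r X \<ge> 0" by (simp add: r_def)
  have "r A \<le> K" using K cA by (simp add: r_def divide_le_eq)
  then have rK: "r X \<le> K" using min[of A] ne by simp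
  have step: "real (card (X + A + C)) \<le> r X * real (card (X + C))" if "finite C" for C
  proof (rule card_plus_minimal_ratio_le[OF fin XA(3) that _ _ r0])
    show "real (card (X + A)) = r X * real (card X)" using cX by (simp add: r_def)
  next
    fix Z assume Z: "Z \<subseteq> X"
    show "r X * real (card Z) \<le> real (card (Z + A))"
    proof (cases "Z = {}")
      case False
      then have "card Z > 0" using Z XA(3) by (meson card_gt_0_iff finite_subset)
      then show ?thesis using min[of Z] Z XA False by (auto simp: r_def field_simps)
    qed simp
  qed
  have "real (card (X + fold_sumset n A)) \<le> r X ^ n * real (card X)"
  proof (induction n)
    case (Suc n)
    have "real (card (X + fold_sumset (Suc n) A)) \<le> r X * real (card (X + fold_sumset n A))"
      using step[OF finite_fold_sumset[OF fin, of n]] by (simp add: add.assoc)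
    also have "\<dots> \<le> r X * (r X ^ n * real (card X))"
      using Suc r0 by (rule mult_left_mono)
    finally show ?case by simp
  qed simp
  also have "\<dots> \<le> K ^ n * real (card A)"
    using rK r0 XA fin by (intro mult_mono power_mono) (auto intro: card_mono)
  finally show ?thesis
    using card_le_card_plus[OF XA(3) finite_fold_sumset[OF fin, of n] XA(2)] by linarith
qed

text \<open>Ruzsa's injection: fix a representation of each difference \<open>d\<close> and send
  \<open>(d, c)\<close> to its two entries shifted by \<open>c\<close>. The difference of the
  shifted entries recovers \<open>d\<close>, and then \<open>c\<close>.\<close>

lemma Ruzsa_difference_le:
  fixes A :: "'a::ab_group_add set"
  assumes fin: "finite A"
  shows "card ((\<lambda>(a, b). a - b) ` (A \<times> A)) * card A \<le> card (A + A) ^ 2"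
proof -
  let ?D = "(\<lambda>(a, b). a - b) ` (A \<times> A)"
  have "\<forall>d\<in>?D. \<exists>p. p \<in> A \<times> A \<and> fst p - snd p = d" by force
  then obtain p where p: "\<And>d. d \<in> ?D \<Longrightarrow> p d \<in> A \<times> A \<and> fst (p d) - snd (p d) = d" by metis
  define h where "h = (\<lambda>(d, c). (fst (p d) + c, snd (p d) + c))"
  have "inj_on h (?D \<times> A)"
  proof (rule inj_onI, clarify)
    fix a b c a' b' c'
    assume "a \<in> A" "b \<in> A" "a' \<in> A" "b' \<in> A" and eq: "h (a - b, c) = h (a' - b', c')"
    then have D: "a - b \<in> ?D" "a' - b' \<in> ?D" by force+
    have e: "fst (p (a - b)) + c = fst (p (a' - b')) + c'"
      "snd (p (a - b)) + c = snd (p (a' - b')) + c'"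
      using eq by (auto simp: h_def)
    then have "fst (p (a - b)) - snd (p (a - b)) = fst (p (a' - b')) - snd (p (a' - b'))"
      by (metis add_diff_cancel_right)
    then have "a - b = a' - b'" using p[OF D(1)] p[OF D(2)] by simp
    then show "a - b = a' - b' \<and> c = c'" using e by simp
  qed
  moreover have "h ` (?D \<times> A) \<subseteq> (A + A) \<times> (A + A)"
  proof
    fix y assume "y \<in> h ` (?D \<times> A)"
    then obtain d c where "d \<in> ?D" "c \<in> A" "y = h (d, c)" by blast
    then show "y \<in> (A + A) \<times> (A + A)" using p[of d] by (auto simp: h_def mem_Times_iff)
  qed
  ultimately have "card (?D \<times> A) \<le> card ((A + A) \<times> (A + A))"
    using fin by (intro card_inj_on_le) (auto intro: finite_set_plus)
  then show ?thesis by (simp add: card_cartesian_product power2_eq_square)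
qed

section \<open>Sums over level sets of integer sumsets\<close>

lemma card_plus_int_ge:
  fixes I J :: "int set"
  assumes fin: "finite I" "finite J" and ne: "I \<noteq> {}" "J \<noteq> {}"
  shows "card I + card J \<le> card (I + J) + 1"
proof -
  \<comment> \<open>The translate of \<open>I\<close> by the least element of \<open>J\<close> and
    that of \<open>J\<close> by the greatest element of \<open>I\<close> share at most one
    endpoint.\<close>
  let ?U = "(\<lambda>i. i + Min J) ` I" and ?V = "(\<lambda>j. j + Max I) ` J"
  have "?U \<union> ?V \<subseteq> I + J"
    using Min_in[OF fin(2) ne(2)] Max_in[OF fin(1) ne(1)] by (auto simp: add.commute[of _ "Max I"])
  then have le: "card (?U \<union> ?V) \<le> card (I + J)"
    using fin by (intro card_mono finite_set_plus)
  have "?U \<inter> ?V \<subseteq> {Max I + Min J}"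
  proof
    fix x assume "x \<in> ?U \<inter> ?V"
    then obtain i j where "i \<in> I" "j \<in> J" "x = i + Min J" "x = j + Max I" by blast
    moreover have "i \<le> Max I" "Min J \<le> j" using calculation fin by auto
    ultimately show "x \<in> {Max I + Min J}" by simp
  qed
  then have "card (?U \<inter> ?V) \<le> 1"
    using card_mono[of "{Max I + Min J}" "?U \<inter> ?V"] by simp
  moreover have "card ?U + card ?V = card (?U \<union> ?V) + card (?U \<inter> ?V)"
    using fin by (intro card_Un_Int) auto
  ultimately show ?thesis using le by (simp add: card_translate)
qed

text \<open>Layer-cake argument: remove the lowest level from all functions at once.\<close>

lemma sum_level_sets_ge:
  fixes I J :: "int set" and \<alpha> \<beta> n :: "int \<Rightarrow> real"
  assumes "finite I" "finite J" "I \<noteq> {}" "J \<noteq> {}"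
    and "\<And>i. i \<in> I \<Longrightarrow> 0 < \<alpha> i \<and> \<alpha> i \<le> t" "\<And>j. j \<in> J \<Longrightarrow> 0 < \<beta> j \<and> \<beta> j \<le> t"
    and "\<exists>i\<in>I. \<alpha> i = t" "\<exists>j\<in>J. \<beta> j = t"
    and "\<And>i j. i \<in> I \<Longrightarrow> j \<in> J \<Longrightarrow> min (\<alpha> i) (\<beta> j) \<le> n (i + j)"
  shows "sum \<alpha> I + sum \<beta> J \<le> sum n (I + J) + t"
  using assms
proof (induction "card I + card J" arbitrary: I J \<alpha> \<beta> n t rule: less_induct)
  case less
  note fin = less.prems(1,2) and ne = less.prems(3,4) and \<alpha> = less.prems(5) and \<beta> = less.prems(6)
    and n = less.prems(9)
  \<comment> \<open>\<open>v\<close> is the lowest level of either function. The slab below it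
    contributes \<open>v\<close> times a cardinality on each side, and the defect of one point in
    the sumset bound costs \<open>v\<close>; over the recursion these costs add up to
    \<open>t\<close>.\<close>
  define v where "v = min (Min (\<alpha> ` I)) (Min (\<beta> ` J))"
  have v\<alpha>: "v \<le> \<alpha> i" if "i \<in> I" for i using that fin by (auto simp: v_def min_le_iff_disj)
  have v\<beta>: "v \<le> \<beta> j" if "j \<in> J" for j using that fin by (auto simp: v_def min_le_iff_disj)
  have vin: "v \<in> \<alpha> ` I \<or> v \<in> \<beta> ` J"
    unfolding v_def min_def using fin ne Min_in[of "\<alpha> ` I"] Min_in[of "\<beta> ` J"] by auto
  have v0: "v > 0" using vin \<alpha> \<beta> by auto
  have nv: "v \<le> n k" if k: "k \<in> I + J" for k
  proof -
    obtain i j where "i \<in> I" "j \<in> J" "k = i + j" using k by (rule set_plus_elim)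
    then show ?thesis using n[of i j] v\<alpha>[of i] v\<beta>[of j] by auto
  qed
  have card: "v * (real (card I) + real (card J) - 1) \<le> v * real (card (I + J))"
    using card_plus_int_ge[OF fin ne] v0 by (intro mult_left_mono) auto
  define I' where "I' = {i \<in> I. \<alpha> i \<noteq> v}"
  define J' where "J' = {j \<in> J. \<beta> j \<noteq> v}"
  have sub: "I' \<subseteq> I" "J' \<subseteq> J" by (auto simp: I'_def J'_def)
  have sI: "sum \<alpha> I = v * real (card I) + (\<Sum>i\<in>I'. \<alpha> i - v)"
  proof -
    have "(\<Sum>i\<in>I'. \<alpha> i - v) = (\<Sum>i\<in>I. \<alpha> i - v)"
      using fin by (intro sum.mono_neutral_left) (auto simp: I'_def)
    then show ?thesis by (simp add: sum_subtractf algebra_simps)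
  qed
  have sJ: "sum \<beta> J = v * real (card J) + (\<Sum>j\<in>J'. \<beta> j - v)"
  proof -
    have "(\<Sum>j\<in>J'. \<beta> j - v) = (\<Sum>j\<in>J. \<beta> j - v)"
      using fin by (intro sum.mono_neutral_left) (auto simp: J'_def)
    then show ?thesis by (simp add: sum_subtractf algebra_simps)
  qed
  have sn: "v * real (card (I + J)) + (\<Sum>k\<in>I' + J'. n k - v) \<le> sum n (I + J)"
  proof -
    have "(\<Sum>k\<in>I' + J'. n k - v) \<le> (\<Sum>k\<in>I + J. n k - v)"
      using fin nv sub by (intro sum_mono2 finite_set_plus set_plus_mono2) auto
    then show ?thesis by (simp add: sum_subtractf algebra_simps)
  qed
  show ?case
  proof (cases "v = t")
    case True
    then have "I' = {}" "J' = {}"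
      using \<alpha> \<beta> v\<alpha> v\<beta> by (auto simp: I'_def J'_def intro: antisym)
    then show ?thesis using sI sJ sn card True by (simp add: algebra_simps)
  next
    case False
    then have ne': "\<exists>i\<in>I'. \<alpha> i - v = t - v" "\<exists>j\<in>J'. \<beta> j - v = t - v"
      using less.prems(7,8) by (auto simp: I'_def J'_def)
    have "card I' + card J' < card I + card J"
    proof -
      have "I' \<subset> I \<or> J' \<subset> J" using vin by (auto simp: I'_def J'_def)
      then show ?thesis using sub fin
        by (metis add_le_less_mono add_less_le_mono card_mono psubset_card_mono)
    qed
    then have "(\<Sum>i\<in>I'. \<alpha> i - v) + (\<Sum>j\<in>J'. \<beta> j - v) \<le> (\<Sum>k\<in>I' + J'. n k - v) + (t - v)"
    proof (rule less.hyps)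
      show "finite I'" "finite J'" using sub fin finite_subset by blast+
      show "I' \<noteq> {}" "J' \<noteq> {}" using ne' by auto
      show "0 < \<alpha> i - v \<and> \<alpha> i - v \<le> t - v" if "i \<in> I'" for i
        using that v\<alpha>[of i] \<alpha>[of i] by (auto simp: I'_def)
      show "0 < \<beta> j - v \<and> \<beta> j - v \<le> t - v" if "j \<in> J'" for j
        using that v\<beta>[of j] \<beta>[of j] by (auto simp: J'_def)
      show "min (\<alpha> i - v) (\<beta> j - v) \<le> n (i + j) - v" if "i \<in> I'" "j \<in> J'" for i j
      proof -
        have "i \<in> I" "j \<in> J" using that sub by auto
        then show ?thesis using n[of i j] by linarith
      qed
    qed (use ne' in auto)
    then show ?thesis using sI sJ sn card by (simp add: algebra_simps)
  qed
qed

subsection \<open>Fibres of a sumset over the integers\<close>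

text \<open>The left side is the tangent at \<open>1\<close> of the convex function
  \<open>y powr (1 + c)\<close>. Adding the bounds \<open>exp u \<ge> 1 + u\<close> at
  \<open>c * ln y\<close> and, with weight \<open>c\<close>, at \<open>- ln y\<close> cancels the
  logarithms.\<close>

lemma powr_Bernoulli:
  fixes y c :: real
  assumes "y > 0" "c \<ge> 0"
  shows "(1 + c) * y - c \<le> y powr (1 + c)"
proof -
  let ?L = "ln y"
  have "c * (1 + - ?L) \<le> c * exp (- ?L)"
    using assms(2) by (intro mult_left_mono exp_ge_add_one_self)
  moreover have "c * exp (- ?L) = c / y" "exp (c * ?L) = y powr c"
    using assms(1) by (simp_all add: powr_def exp_minus divide_inverse)
  ultimately have "1 + c \<le> y powr c + c / y"
    using exp_ge_add_one_self[of "c * ?L"] by (simp only: distrib_left mult_1_right mult_minus_right)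
  then have "(1 + c) * y \<le> (y powr c + c / y) * y"
    using assms(1) by (intro mult_right_mono) auto
  also have "\<dots> = y powr (1 + c) + c"
    using assms(1) by (simp add: powr_add algebra_simps)
  finally show ?thesis by simp
qed

text \<open>Hoelder's inequality: the tangent bound is applied to each summand at the common ratio
  \<open>r\<close> of the two totals, and the linear terms then add up exactly.\<close>

lemma sum_powr_ge:
  fixes x m :: "'i \<Rightarrow> real"
  assumes fin: "finite I" "I \<noteq> {}" and c: "c \<ge> 0"
    and x: "\<And>i. i \<in> I \<Longrightarrow> x i > 0" and m: "\<And>i. i \<in> I \<Longrightarrow> m i > 0"
  shows "sum x I powr (1 + c) * sum m I powr (- c) \<le> (\<Sum>i\<in>I. x i powr (1 + c) * m i powr (- c))"
proof -
  let ?X = "sum x I" and ?M = "sum m I"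
  have X: "?X > 0" and M: "?M > 0" using x m fin by (auto intro: sum_pos)
  define r where "r = ?X / ?M"
  have r: "r > 0" using X M by (simp add: r_def)
  have "(1 + c) * r powr c * x i - c * r powr (1 + c) * m i \<le> x i powr (1 + c) * m i powr (- c)"
    if "i \<in> I" for i
  proof -
    have xi: "x i > 0" and mi: "m i > 0" using x m that by auto
    define y where "y = x i / m i / r"
    have y: "y > 0" using xi mi r by (simp add: y_def)
    have "(r powr (1 + c) * m i) * ((1 + c) * y - c) \<le> (r powr (1 + c) * m i) * y powr (1 + c)"
      using powr_Bernoulli[OF y c] mi by (intro mult_left_mono) auto
    moreover have "(r powr (1 + c) * m i) * ((1 + c) * y - c) =
        (1 + c) * r powr c * x i - c * r powr (1 + c) * m i"
      using r mi by (simp add: y_def powr_add field_simps)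
    moreover have "(r powr (1 + c) * m i) * y powr (1 + c) = x i powr (1 + c) * m i powr (- c)"
      using r mi xi by (simp add: y_def powr_divide powr_mult powr_add powr_minus field_simps)
    ultimately show ?thesis by simp
  qed
  then have "(\<Sum>i\<in>I. (1 + c) * r powr c * x i - c * r powr (1 + c) * m i) \<le>
      (\<Sum>i\<in>I. x i powr (1 + c) * m i powr (- c))"
    by (rule sum_mono)
  moreover have "(\<Sum>i\<in>I. (1 + c) * r powr c * x i - c * r powr (1 + c) * m i) =
      (1 + c) * r powr c * ?X - c * r powr (1 + c) * ?M"
    by (simp add: sum_subtractf sum_distrib_left)
  moreover have "\<dots> = ?X powr (1 + c) * ?M powr (- c)"
    using X M by (simp add: r_def powr_divide powr_add powr_minus field_simps)
  ultimately show ?thesis by simp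
qed

lemma card_eq_sum_fibres:
  assumes "finite X" "finite I" "v ` X \<subseteq> I"
  shows "card X = (\<Sum>i\<in>I. card {x \<in> X. v x = i})"
proof -
  have "card X = (\<Sum>x\<in>X. 1)" by simp
  also have "\<dots> = (\<Sum>i\<in>I. \<Sum>x | x \<in> X \<and> v x = i. 1)"
    using assms by (rule sum.group[symmetric])
  finally show ?thesis by simp
qed

text \<open>Here \<open>P\<close> is the sum of the weights of the fibres divided by the largest weight. If \<open>P\<close> is not close
  to \<open>1\<close>, the sumset of the two sets of fibres is larger than either by a constant factor; otherwise the
  small fibres contribute through their sums with the largest one, which gives the square root.\<close>

definition gain :: "real \<Rightarrow> real" where
  "gain P = (if P \<ge> 1 + 1 / 2 ^ 28 then (1 + 1 / 2 ^ 29) * P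
    else min (1 + sqrt (P - 1)) (1 + 1 / 2 ^ 15))"

lemma gain_ge_one: "P \<ge> 1 \<Longrightarrow> gain P \<ge> 1"
proof (cases "P \<ge> 1 + 1 / 2 ^ 28")
  case True
  then have "(1 + 1 / 2 ^ 29) * P \<ge> 1 * 1" by (intro mult_mono) auto
  then show ?thesis using True by (simp add: gain_def)
qed (auto simp: gain_def)

text \<open>\<open>P\<close> and \<open>Q\<close> are normalised totals of fibre weights,
  \<open>P1\<close> and \<open>Q1\<close> the corresponding totals of square roots, and
  \<open>h\<close> the normalised size of the sumset. The bounds on \<open>h\<close> come from the
  largest fibre on either side and from the layer-cake argument.\<close>

lemma gain_mult_le:
  fixes P Q P1 Q1 h :: real
  assumes P: "P \<ge> 1" "P1 \<ge> P" "P1 \<ge> 1 + sqrt (P - 1)"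
    and Q: "Q \<ge> 1" "Q1 \<ge> Q" "Q1 \<ge> 1 + sqrt (Q - 1)"
    and h: "h \<ge> P1" "h \<ge> Q1" "h \<ge> P + Q - 1"
  shows "gain P * gain Q \<le> h\<^sup>2"
proof -
  have mixed: "gain p * gain r \<le> h\<^sup>2"
    if p: "p \<ge> 1 + 1 / 2 ^ 28" and r: "r \<ge> 1" "\<not> r \<ge> 1 + 1 / 2 ^ 28"
      and hp: "h \<ge> p" "h \<ge> 1 + sqrt (p - 1)" for p r
  proof -
    \<comment> \<open>At the threshold \<open>1 + 1 / 2 ^ 28\<close> the square root contributes
      \<open>1 / 2 ^ 14\<close>, which covers both the factor \<open>1 + 1 / 2 ^ 29\<close> in
      \<open>gain p\<close> and the cap \<open>1 + 1 / 2 ^ 15\<close> on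
      \<open>gain r\<close>.\<close>
    have "sqrt ((1 / 2 ^ 14)\<^sup>2) \<le> sqrt (p - 1)"
      using p by (intro real_sqrt_le_mono) (auto simp: power_divide)
    then have s: "1 + 1 / 2 ^ 14 \<le> 1 + sqrt (p - 1)" by simp
    have "gain p = (1 + 1 / 2 ^ 29) * p" using p by (simp only: gain_def if_True)
    moreover have "gain r \<le> 1 + 1 / 2 ^ 15" using r by (simp only: gain_def if_False min.cobounded2)
    moreover have "0 \<le> (1 + 1 / 2 ^ 29) * p" using p by simp
    ultimately have "gain p * gain r \<le> ((1 + 1 / 2 ^ 29) * p) * (1 + 1 / 2 ^ 15)"
      by (simp only: mult_left_mono)
    also have "\<dots> = p * ((1 + 1 / 2 ^ 29) * (1 + 1 / 2 ^ 15))" by simp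
    also have "\<dots> \<le> p * (1 + 1 / 2 ^ 14)" using p by (intro mult_left_mono) auto
    also have "\<dots> \<le> h * h" using hp s p by (intro mult_mono) auto
    finally show ?thesis by (simp add: power2_eq_square)
  qed
  consider "P \<ge> 1 + 1 / 2 ^ 28" "Q \<ge> 1 + 1 / 2 ^ 28"
    | "P \<ge> 1 + 1 / 2 ^ 28" "\<not> Q \<ge> 1 + 1 / 2 ^ 28"
    | "\<not> P \<ge> 1 + 1 / 2 ^ 28" "Q \<ge> 1 + 1 / 2 ^ 28"
    | "\<not> P \<ge> 1 + 1 / 2 ^ 28" "\<not> Q \<ge> 1 + 1 / 2 ^ 28"
    by blast
  then show ?thesis
  proof cases
    case 1
    let ?g = "sqrt (P * Q)"
    have "(1 + 1 / 2 ^ 28) * (1 + 1 / 2 ^ 28) \<le> P * Q" using 1 by (intro mult_mono) auto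
    then have g: "?g \<ge> 1 + 1 / 2 ^ 28"
      by (intro real_le_rsqrt) (simp add: power2_eq_square)
    \<comment> \<open>Thus \<open>P + Q - 1 \<ge> 2 * ?g - 1\<close>, and this is at least
      \<open>(1 + 1 / 2 ^ 29) * ?g\<close> because \<open>?g \<ge> 1 + 1 / 2 ^ 28\<close>.\<close>
    have am: "2 * ?g \<le> P + Q"
      using arith_geo_mean_sqrt[of P Q] P Q by simp
    have "(1 + 1 / 2 ^ 29) * ?g \<le> P + Q - 1"
      using g am by (simp add: field_simps)
    then have "(1 + 1 / 2 ^ 29) * ?g \<le> h" using h by linarith
    then have "((1 + 1 / 2 ^ 29) * ?g)\<^sup>2 \<le> h\<^sup>2" using P Q by (intro power_mono) auto
    moreover have "((1 + 1 / 2 ^ 29) * ?g)\<^sup>2 = gain P * gain Q"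
      using 1 P Q by (simp add: gain_def power_mult_distrib power2_eq_square)
    ultimately show ?thesis by simp
  next
    case 2
    then show ?thesis using mixed[of P Q] P Q h by auto
  next
    case 3
    then show ?thesis using mixed[of Q P] P Q h by (auto simp: mult.commute)
  next
    case 4
    have "gain P \<le> h" "gain Q \<le> h" using 4 P Q h by (auto simp: gain_def)
    then show ?thesis using gain_ge_one[of P] gain_ge_one[of Q] P Q
      unfolding power2_eq_square by (intro mult_mono) auto
  qed
qed

lemma powr_neg_antimono:
  fixes a b c :: real
  shows "0 < a \<Longrightarrow> a \<le> b \<Longrightarrow> c \<ge> 0 \<Longrightarrow> b powr (- c) \<le> a powr (- c)"
  by (rule powr_mono2') auto

text \<open>If the total of the \<open>\<alpha> i\<close> well exceeds \<open>\<alpha> i0\<close>,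
  Hoelder's inequality loses only \<open>\<theta> powr c\<close> against the whole. Otherwise either
  \<open>\<alpha> i0\<close> already suffices, or the fibre \<open>i0\<close> carries all but a
  small fraction \<open>\<eta>\<close> of \<open>sum x I\<close>; it then loses order
  \<open>\<eta>\<close>, and the square root in \<open>gain\<close> recovers more from the remaining
  fibres.\<close>

lemma gain_fibres:
  fixes x m :: "'i \<Rightarrow> real"
  assumes fin: "finite I" and x: "\<And>i. i \<in> I \<Longrightarrow> x i > 0" and m: "\<And>i. i \<in> I \<Longrightarrow> m i > 0"
    and M: "\<And>i. i \<in> I \<Longrightarrow> m i \<le> M" and \<theta>M: "\<theta> * sum m I \<le> M"
    and \<theta>: "0 < \<theta>" and c: "0 \<le> c" "c \<le> 1 / 2"
    and \<theta>c: "\<theta> powr (- c) \<le> 1 + 1 / 2 ^ 29"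
    and i0: "i0 \<in> I"
  defines "\<alpha> \<equiv> \<lambda>i. x i powr (1 + c) * m i powr (- c)"
  shows "sum x I powr (1 + c) * M powr (- c) \<le> gain (sum \<alpha> I / \<alpha> i0) * \<alpha> i0"
proof -
  let ?X = "sum x I"
  define \<Phi> where "\<Phi> = ?X powr (1 + c) * M powr (- c)"
  define P where "P = sum \<alpha> I / \<alpha> i0"
  have ne: "I \<noteq> {}" using i0 by blast
  have \<alpha>pos: "\<alpha> i > 0" if "i \<in> I" for i using x[OF that] m[OF that] by (simp add: \<alpha>_def)
  have X: "?X > 0" using x fin ne by (auto intro: sum_pos)
  have M0: "M > 0" using m[OF i0] M[OF i0] by linarith
  have \<Phi>0: "\<Phi> > 0" using X M0 by (simp add: \<Phi>_def)
  have a0: "\<alpha> i0 > 0" using \<alpha>pos i0 by blast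
  have PS: "P * \<alpha> i0 = sum \<alpha> I" using a0 by (simp add: P_def)
  have "\<alpha> i0 \<le> sum \<alpha> I"
    using i0 fin \<alpha>pos by (intro member_le_sum) (auto intro: less_imp_le)
  then have P1: "P \<ge> 1" using a0 by (simp add: P_def)
  have part: "\<theta> powr c * (sum x J powr (1 + c) * M powr (- c)) \<le> sum \<alpha> J"
    if J: "J \<subseteq> I" "J \<noteq> {}" for J
  proof -
    have fJ: "finite J" using J fin finite_subset by blast
    have mJ: "sum m J > 0" using J fJ m by (intro sum_pos) auto
    have "sum m J \<le> sum m I" using J fin m by (intro sum_mono2) (auto intro: less_imp_le)
    then have "\<theta> * sum m J \<le> M" using \<theta>M \<theta> by (meson mult_left_mono less_imp_le order_trans)
    then have "M powr (- c) \<le> (\<theta> * sum m J) powr (- c)"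
      using \<theta> mJ c by (intro powr_neg_antimono) auto
    also have "\<dots> = \<theta> powr (- c) * sum m J powr (- c)" using \<theta> mJ by (simp add: powr_mult)
    finally have "\<theta> powr c * M powr (- c) \<le> \<theta> powr c * (\<theta> powr (- c) * sum m J powr (- c))"
      by (intro mult_left_mono) auto
    also have "\<dots> = sum m J powr (- c)" using \<theta> by (simp add: powr_minus)
    finally have "sum x J powr (1 + c) * (\<theta> powr c * M powr (- c)) \<le>
        sum x J powr (1 + c) * sum m J powr (- c)"
      by (intro mult_left_mono) auto
    also have "\<dots> \<le> sum \<alpha> J"
      unfolding \<alpha>_def using J x m by (intro sum_powr_ge fJ c) auto
    finally show ?thesis by (simp add: ac_simps)
  qed
  have \<theta>1: "1 \<le> (1 + 1 / 2 ^ 29) * \<theta> powr c"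
    using mult_right_mono[OF \<theta>c, of "\<theta> powr c"] \<theta> by (simp add: powr_minus)
  have goal: "\<Phi> \<le> gain P * \<alpha> i0"
  proof (cases "P \<ge> 1 + 1 / 2 ^ 28")
    case True
    have "\<Phi> \<le> ((1 + 1 / 2 ^ 29) * \<theta> powr c) * \<Phi>" using \<theta>1 \<Phi>0 by (simp only: mult_le_cancel_right1) simp
    also have "\<dots> = (1 + 1 / 2 ^ 29) * (\<theta> powr c * \<Phi>)" by simp
    also have "\<dots> \<le> (1 + 1 / 2 ^ 29) * sum \<alpha> I"
      using part[OF order_refl ne] by (intro mult_left_mono) (auto simp: \<Phi>_def)
    also have "\<dots> = gain P * \<alpha> i0" using True PS by (simp add: gain_def)
    finally show ?thesis .
  next
    case small: False
    show ?thesis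
    proof (cases "\<alpha> i0 \<ge> \<Phi>")
      case True
      also have "\<alpha> i0 \<le> gain P * \<alpha> i0"
        using mult_right_mono[OF gain_ge_one[OF P1], of "\<alpha> i0"] a0 by simp
      finally show ?thesis .
    next
      case False
      define \<eta> where "\<eta> = 1 - x i0 / ?X"
      have x0: "x i0 \<le> ?X" using i0 fin x by (intro member_le_sum) (auto intro: less_imp_le)
      have \<eta>: "0 \<le> \<eta>" "\<eta> < 1" using x0 X x[OF i0] by (auto simp: \<eta>_def)
      have x0\<eta>: "x i0 = (1 - \<eta>) * ?X" using X by (simp add: \<eta>_def)
      define z where "z = sqrt \<eta>"
      have z: "z \<ge> 0" "z\<^sup>2 = \<eta>" using \<eta> by (auto simp: z_def)
      \<comment> \<open>Since \<open>1 + c \<le> 2\<close>, the fibre \<open>i0\<close> keeps at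
        least the square of \<open>1 - \<eta>\<close> as a share of \<open>\<Phi>\<close>, hence
        loses at most \<open>2 * \<eta>\<close>.\<close>
      have A: "(1 - 2 * z\<^sup>2) * \<Phi> \<le> \<alpha> i0"
      proof -
        have "1 - 2 * z\<^sup>2 \<le> (1 - \<eta>)\<^sup>2" unfolding z(2) by (simp add: power2_diff)
        also have "\<dots> = (1 - \<eta>) powr 2" using \<eta> by simp
        also have "\<dots> \<le> (1 - \<eta>) powr (1 + c)" using \<eta> c by (intro powr_mono') auto
        finally have "(1 - 2 * z\<^sup>2) * \<Phi> \<le> (1 - \<eta>) powr (1 + c) * \<Phi>"
          using \<Phi>0 by (intro mult_right_mono) auto
        also have "\<dots> = x i0 powr (1 + c) * M powr (- c)"
          unfolding x0\<eta> \<Phi>_def using \<eta> X by (simp add: powr_mult)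
        also have "\<dots> \<le> \<alpha> i0"
          unfolding \<alpha>_def using m[OF i0] M[OF i0] c by (intro mult_left_mono powr_neg_antimono) auto
        finally show ?thesis .
      qed
      \<comment> \<open>The remaining fibres hold at least
        \<open>\<theta> powr c * \<eta> powr (1 + c)\<close> of \<open>\<Phi>\<close>; the bound
        \<open>1 + c \<le> 3 / 2\<close> turns the power of \<open>\<eta>\<close> into
        \<open>z ^ 3\<close>, and \<open>1 / 2\<close> absorbs
        \<open>\<theta> powr c\<close>.\<close>
      have B: "z ^ 3 / 2 \<le> P - 1"
      proof (cases "\<eta> = 0")
        case True
        then show ?thesis using z P1 by simp
      next
        case nz: False
        have "I - {i0} \<noteq> {}"
        proof
          assume "I - {i0} = {}"
          then have "I = {i0}" using i0 by blast
          then show False using nz X by (simp add: \<eta>_def)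
        qed
        then have "\<theta> powr c * (sum x (I - {i0}) powr (1 + c) * M powr (- c)) \<le> sum \<alpha> (I - {i0})"
          by (intro part) auto
        moreover have "sum x (I - {i0}) = \<eta> * ?X"
          using i0 fin x0\<eta> by (simp add: sum_diff1 algebra_simps)
        moreover have "sum \<alpha> (I - {i0}) = (P - 1) * \<alpha> i0"
          using i0 fin PS by (simp add: sum_diff1 algebra_simps)
        ultimately have "\<theta> powr c * (\<eta> powr (1 + c) * \<Phi>) \<le> (P - 1) * \<alpha> i0"
          using \<eta> X by (simp add: powr_mult \<Phi>_def mult.assoc)
        also have "\<dots> \<le> (P - 1) * \<Phi>" using False P1 by (intro mult_left_mono) auto
        finally have "(\<theta> powr c * \<eta> powr (1 + c)) * \<Phi> \<le> (P - 1) * \<Phi>" by (simp add: mult.assoc)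
        then have "\<theta> powr c * \<eta> powr (1 + c) \<le> P - 1" using \<Phi>0 by (simp only: mult_le_cancel_right_pos)
        moreover have "z ^ 3 \<le> \<eta> powr (1 + c)"
        proof -
          have "z ^ 3 = \<eta> powr (1 / 2) * \<eta>"
            using \<eta> by (simp add: z_def power3_eq_cube powr_half_sqrt)
          also have "\<dots> = \<eta> powr (1 / 2 + 1)" unfolding powr_add using \<eta> by simp
          also have "\<dots> \<le> \<eta> powr (1 + c)" using \<eta> c by (intro powr_mono') auto
          finally show ?thesis .
        qed
        moreover have "1 / 2 \<le> \<theta> powr c" using \<theta>1 by simp
        ultimately have "1 / 2 * z ^ 3 \<le> P - 1"
          using z(1) by (meson mult_mono order_trans powr_ge_zero zero_le_power)
        then show ?thesis by simp
      qed
      \<comment> \<open>\<open>P - 1 < 1 / 2 ^ 28\<close> gives \<open>z ^ 3 < 1 / 2 ^ 27\<close>.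
        For so small a \<open>z\<close> the square of \<open>4 * z ^ 2\<close> is below
        \<open>z ^ 3 / 2\<close>, so the square root in \<open>gain\<close> outweighs the loss
        \<open>2 * z ^ 2\<close>.\<close>
      have "z ^ 3 \<le> (1 / 2 ^ 9) ^ 3" using B small by (simp add: power_divide)
      then have z9: "z \<le> 1 / 2 ^ 9" using z(1) by (subst (asm) power_mono_iff) auto
      have zz: "z\<^sup>2 \<le> (1 / 2 ^ 9)\<^sup>2" using z9 z(1) by (rule power_mono)
      have "(4 * z\<^sup>2)\<^sup>2 = z ^ 3 * (16 * z)" by (simp add: power2_eq_square power3_eq_cube)
      also have "\<dots> \<le> z ^ 3 * (1 / 2)" using z9 z(1) by (intro mult_left_mono) auto
      also have "\<dots> \<le> P - 1" using B by simp
      finally have "4 * z\<^sup>2 \<le> sqrt (P - 1)" by (rule real_le_rsqrt)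
      moreover have "4 * z\<^sup>2 \<le> 1 / 2 ^ 15" using zz by (simp add: power_divide)
      ultimately have g: "1 + 4 * z\<^sup>2 \<le> gain P" using small by (simp add: gain_def)
      have "0 \<le> z\<^sup>2 * (2 - 8 * z\<^sup>2)"
        using zz by (intro mult_nonneg_nonneg) (auto simp: power_divide)
      then have "1 \<le> (1 + 4 * z\<^sup>2) * (1 - 2 * z\<^sup>2)" by (simp add: algebra_simps)
      then have "1 * \<Phi> \<le> ((1 + 4 * z\<^sup>2) * (1 - 2 * z\<^sup>2)) * \<Phi>" using \<Phi>0 by (intro mult_right_mono) auto
      then have "\<Phi> \<le> (1 + 4 * z\<^sup>2) * ((1 - 2 * z\<^sup>2) * \<Phi>)" by (simp add: mult.assoc)
      also have "\<dots> \<le> (1 + 4 * z\<^sup>2) * \<alpha> i0" using A by (intro mult_left_mono) auto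
      also have "\<dots> \<le> gain P * \<alpha> i0" using g a0 by (intro mult_right_mono) auto
      finally show ?thesis .
    qed
  qed
  show ?thesis using goal by (simp only: \<Phi>_def P_def)
qed

lemma sum_sqrt_ge:
  fixes a :: "'i \<Rightarrow> real"
  assumes fin: "finite I" and i0: "i0 \<in> I" and a: "\<And>i. i \<in> I \<Longrightarrow> 0 < a i \<and> a i \<le> 1" and a0: "a i0 = 1"
  shows "sum a I \<ge> 1" "sum a I \<le> (\<Sum>i\<in>I. sqrt (a i))"
    "1 + sqrt (sum a I - 1) \<le> (\<Sum>i\<in>I. sqrt (a i))"
proof -
  let ?J = "I - {i0}"
  have split: "sum h I = h i0 + sum h ?J" for h :: "'i \<Rightarrow> real"
    using fin i0 by (simp add: sum.remove)
  have nn: "sum a ?J \<ge> 0" using a by (intro sum_nonneg) (auto intro: less_imp_le)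
  then show "sum a I \<ge> 1" using split[of a] a0 by simp
  show "sum a I \<le> (\<Sum>i\<in>I. sqrt (a i))"
  proof (rule sum_mono)
    fix i assume "i \<in> I"
    then have "0 \<le> a i" "a i \<le> 1" using a by (auto intro: less_imp_le)
    then have "(a i)\<^sup>2 \<le> a i" by (simp add: power2_eq_square mult_left_le)
    then show "a i \<le> sqrt (a i)" by (rule real_le_rsqrt)
  qed
  have "sum a ?J \<le> (\<Sum>i\<in>?J. sqrt (a i))\<^sup>2"
  proof -
    let ?s = "\<Sum>i\<in>?J. sqrt (a i)"
    have "a i \<le> sqrt (a i) * ?s" if "i \<in> ?J" for i
    proof -
      have "sqrt (a i) \<le> ?s"
        using that fin a by (intro member_le_sum) (auto intro: less_imp_le)
      then have "sqrt (a i) * sqrt (a i) \<le> sqrt (a i) * ?s"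
        using a[of i] that by (intro mult_left_mono) (auto intro: less_imp_le)
      then show ?thesis using a[of i] that by (auto intro: less_imp_le)
    qed
    then have "sum a ?J \<le> (\<Sum>i\<in>?J. sqrt (a i) * ?s)" by (rule sum_mono)
    then show ?thesis by (simp add: sum_distrib_right power2_eq_square)
  qed
  then have "sqrt (sum a ?J) \<le> (\<Sum>i\<in>?J. sqrt (a i))"
    using a by (intro real_le_lsqrt sum_nonneg) (auto intro: less_imp_le)
  then show "1 + sqrt (sum a I - 1) \<le> (\<Sum>i\<in>I. sqrt (a i))"
    using split[of a] split[of "\<lambda>i. sqrt (a i)"] a0 by simp
qed

text \<open>Dividing by the largest weights turns the hypothesis on \<open>n\<close> into a lower
  bound by products of square roots. Summing against the largest fibre of either side gives two
  bounds on the sumset; the third is the layer-cake bound, as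
  \<open>min x y \<le> sqrt (x * y)\<close> for nonnegative numbers.\<close>

lemma sumset_fibres_ge:
  fixes I J :: "int set" and \<alpha> \<beta> n :: "int \<Rightarrow> real"
  assumes fin: "finite I" "finite J" and i0: "i0 \<in> I" and j0: "j0 \<in> J"
    and \<alpha>: "\<And>i. i \<in> I \<Longrightarrow> 0 < \<alpha> i \<and> \<alpha> i \<le> \<alpha> i0" and \<beta>: "\<And>j. j \<in> J \<Longrightarrow> 0 < \<beta> j \<and> \<beta> j \<le> \<beta> j0"
    and n: "\<And>i j. i \<in> I \<Longrightarrow> j \<in> J \<Longrightarrow> sqrt (\<alpha> i * \<beta> j) \<le> n (i + j)"
  shows "(gain (sum \<alpha> I / \<alpha> i0) * \<alpha> i0) * (gain (sum \<beta> J / \<beta> j0) * \<beta> j0) \<le> (sum n (I + J))\<^sup>2"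
proof -
  define a where "a = (\<lambda>i. \<alpha> i / \<alpha> i0)"
  define b where "b = (\<lambda>j. \<beta> j / \<beta> j0)"
  define r where "r = sqrt (\<alpha> i0 * \<beta> j0)"
  have pos: "\<alpha> i0 > 0" "\<beta> j0 > 0" using \<alpha>[OF i0] \<beta>[OF j0] by auto
  then have r: "r > 0" by (simp add: r_def)
  define N where "N = (\<lambda>k. n k / r)"
  have a: "0 < a i \<and> a i \<le> 1" if "i \<in> I" for i using \<alpha>[OF that] pos by (simp add: a_def)
  have b: "0 < b j \<and> b j \<le> 1" if "j \<in> J" for j using \<beta>[OF that] pos by (simp add: b_def)
  have a0: "a i0 = 1" and b0: "b j0 = 1" using pos by (auto simp: a_def b_def)
  have N: "sqrt (a i) * sqrt (b j) \<le> N (i + j)" if "i \<in> I" "j \<in> J" for i j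
  proof -
    have "sqrt (a i) * sqrt (b j) = sqrt (\<alpha> i * \<beta> j) / r"
      by (simp add: a_def b_def r_def real_sqrt_mult real_sqrt_divide)
    then show ?thesis using n[OF that] r by (simp add: N_def divide_right_mono)
  qed
  have N0: "0 \<le> N k" if k: "k \<in> I + J" for k
  proof -
    obtain i j where ij: "i \<in> I" "j \<in> J" "k = i + j" using k by (rule set_plus_elim)
    have "0 \<le> sqrt (a i) * sqrt (b j)" using a[OF ij(1)] b[OF ij(2)] by simp
    then show ?thesis using N[OF ij(1,2)] ij(3) by simp
  qed
  have h1: "(\<Sum>i\<in>I. sqrt (a i)) \<le> sum N (I + J)"
  proof -
    have "(\<Sum>i\<in>I. sqrt (a i)) \<le> (\<Sum>i\<in>I. N (i + j0))"
      using N[OF _ j0] b0 by (intro sum_mono) simp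
    also have "\<dots> = sum N ((\<lambda>i. i + j0) ` I)" by (simp add: sum.reindex)
    also have "\<dots> \<le> sum N (I + J)"
      using fin j0 N0 by (intro sum_mono2 finite_set_plus) auto
    finally show ?thesis .
  qed
  have h2: "(\<Sum>j\<in>J. sqrt (b j)) \<le> sum N (I + J)"
  proof -
    have "(\<Sum>j\<in>J. sqrt (b j)) \<le> (\<Sum>j\<in>J. N (i0 + j))"
      using N[OF i0] a0 by (intro sum_mono) simp
    also have "\<dots> = sum N ((\<lambda>j. i0 + j) ` J)" by (simp add: sum.reindex)
    also have "\<dots> \<le> sum N (I + J)"
      using fin i0 N0 by (intro sum_mono2 finite_set_plus) auto
    finally show ?thesis .
  qed
  have h3: "sum a I + sum b J \<le> sum N (I + J) + 1"
  proof (rule sum_level_sets_ge[OF fin])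
    show "I \<noteq> {}" "J \<noteq> {}" using i0 j0 by auto
    show "\<exists>i\<in>I. a i = 1" "\<exists>j\<in>J. b j = 1" using i0 j0 a0 b0 by auto
    show "min (a i) (b j) \<le> N (i + j)" if ij: "i \<in> I" "j \<in> J" for i j
    proof -
      let ?m = "min (a i) (b j)"
      have "?m = sqrt ?m * sqrt ?m" using a[OF ij(1)] b[OF ij(2)] by simp
      also have "\<dots> \<le> sqrt (a i) * sqrt (b j)"
        using a[OF ij(1)] b[OF ij(2)] by (intro mult_mono real_sqrt_le_mono) auto
      finally show ?thesis using N[OF ij] by linarith
    qed
  qed (use a b in auto)
  have "gain (sum a I) * gain (sum b J) \<le> (sum N (I + J))\<^sup>2"
    using sum_sqrt_ge[where a = a, OF fin(1) i0 a a0] sum_sqrt_ge[where a = b, OF fin(2) j0 b b0] h1 h2 h3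
    by (intro gain_mult_le[where ?P1.0 = "\<Sum>i\<in>I. sqrt (a i)" and ?Q1.0 = "\<Sum>j\<in>J. sqrt (b j)"]) auto
  then have "gain (sum a I) * gain (sum b J) * r\<^sup>2 \<le> (sum N (I + J))\<^sup>2 * r\<^sup>2"
    by (rule mult_right_mono) simp
  moreover have "r\<^sup>2 = \<alpha> i0 * \<beta> j0" using pos by (simp add: r_def)
  moreover have "sum N (I + J) * r = sum n (I + J)"
    using r by (simp add: N_def sum_divide_distrib[symmetric])
  moreover have "sum a I = sum \<alpha> I / \<alpha> i0" "sum b J = sum \<beta> J / \<beta> j0"
    by (simp_all add: a_def b_def sum_divide_distrib)
  moreover have "(gain (sum a I) * \<alpha> i0) * (gain (sum b J) * \<beta> j0) = gain (sum a I) * gain (sum b J) * (\<alpha> i0 * \<beta> j0)"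
    by (simp only: ac_simps)
  moreover have "(sum N (I + J))\<^sup>2 * r\<^sup>2 = (sum N (I + J) * r)\<^sup>2" by (simp only: power_mult_distrib)
  ultimately show ?thesis by (simp only:)
qed

text \<open>The functional \<open>\<mu>\<close> measures how well a set decomposes along the homomorphisms in \<open>V\<close>. Splitting
  along one homomorphism costs a factor \<open>\<theta>\<close> in \<open>\<mu>\<close>, which the exponent \<open>c\<close> makes negligible against
  the growth of the sumset.\<close>

theorem card_sumset_ge:
  fixes V :: "('a::ab_group_add \<Rightarrow> int) set" and \<mu> :: "'a set \<Rightarrow> real" and U :: "'a set"
  assumes hom: "\<And>v x y. v \<in> V \<Longrightarrow> v (x + y) = v x + v y"
    and sep: "\<And>x y. x \<in> U \<Longrightarrow> y \<in> U \<Longrightarrow> (\<And>v. v \<in> V \<Longrightarrow> v x = v y) \<Longrightarrow> x = y"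
    and \<mu>1: "\<And>A. finite A \<Longrightarrow> A \<noteq> {} \<Longrightarrow> \<mu> A \<ge> 1"
    and \<mu>mono: "\<And>A B. finite B \<Longrightarrow> A \<subseteq> B \<Longrightarrow> \<mu> A \<le> \<mu> B"
    and \<mu>split: "\<And>v A. v \<in> V \<Longrightarrow> finite A \<Longrightarrow> \<theta> * (\<Sum>j\<in>v ` A. \<mu> {x \<in> A. v x = j}) \<le> \<mu> A"
    and \<theta>: "0 < \<theta>" and c: "0 \<le> c" "c \<le> 1 / 2" and \<theta>c: "\<theta> powr (- c) \<le> 1 + 1 / 2 ^ 29"
    and AB: "finite A" "finite B" "A \<noteq> {}" "B \<noteq> {}" "A \<subseteq> U" "B \<subseteq> U"
  shows "(real (card A) powr (1 + c) * \<mu> A powr (- c)) * (real (card B) powr (1 + c) * \<mu> B powr (- c))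
    \<le> (real (card (A + B)))\<^sup>2"
  using AB
proof (induction "card A + card B" arbitrary: A B rule: less_induct)
  case less
  note A = less.prems(1,3,5) and B = less.prems(2,4,6)
  define F where "F = (\<lambda>X. real (card X) powr (1 + c) * \<mu> X powr (- c))"
  show ?case
  proof (cases "card A = 1 \<and> card B = 1")
    case True
    \<comment> \<open>For two singletons both factors on the left are at most \<open>1\<close>,
      because \<open>\<mu>\<close> is at least \<open>1\<close>.\<close>
    have "\<mu> A powr (- c) \<le> 1 powr (- c)" "\<mu> B powr (- c) \<le> 1 powr (- c)"
      using \<mu>1[OF A(1,2)] \<mu>1[OF B(1,2)] c by (intro powr_neg_antimono; simp)+
    then have "\<mu> A powr (- c) * \<mu> B powr (- c) \<le> 1 * 1"
      by (intro mult_mono) auto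
    moreover have "card (A + B) \<ge> 1"
      using card_le_card_plus[OF A(1) B(1) A(2)] True by simp
    then have "(real (card (A + B)))\<^sup>2 \<ge> 1" by simp
    ultimately show ?thesis using True by simp
  next
    case False
    have "\<exists>v\<in>V. \<exists>Z\<in>{A, B}. \<exists>x\<in>Z. \<exists>y\<in>Z. v x \<noteq> v y"
    proof -
      have "card A > 1 \<or> card B > 1"
        using False A B by (metis One_nat_def Suc_lessI card_gt_0_iff)
      then have "\<exists>Z\<in>{A, B}. card Z > 1" by auto
      then obtain Z where Z: "Z \<in> {A, B}" "card Z > 1" by blast
      have "\<exists>x\<in>Z. \<exists>y\<in>Z. x \<noteq> y" using Z(2) by (metis card_le_Suc0_iff_eq card.infinite
            One_nat_def not_less not_less_zero)
      then obtain x y where xy: "x \<in> Z" "y \<in> Z" "x \<noteq> y" by blast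
      moreover have "x \<in> U" "y \<in> U" using xy Z(1) A(3) B(3) by auto
      ultimately show ?thesis using sep Z(1) by blast
    qed
    then obtain v Z x y where v: "v \<in> V" and "Z = A \<or> Z = B" "x \<in> Z" "y \<in> Z" "v x \<noteq> v y"
      by blast
    then have branch: "(\<exists>x\<in>A. \<exists>y\<in>A. v x \<noteq> v y) \<or> (\<exists>x\<in>B. \<exists>y\<in>B. v x \<noteq> v y)" by blast
    define Af where "Af = (\<lambda>i. {x \<in> A. v x = i})"
    define Bf where "Bf = (\<lambda>j. {x \<in> B. v x = j})"
    define S where "S = (\<lambda>k. {x \<in> A + B. v x = k})"
    let ?I = "v ` A" and ?J = "v ` B"
    have finI: "finite ?I" "finite ?J" using A B by auto
    have ne: "?I \<noteq> {}" "?J \<noteq> {}" using A B by auto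
    have Af: "finite (Af i)" "Af i \<noteq> {}" "Af i \<subseteq> U" if "i \<in> ?I" for i
      using that A by (auto simp: Af_def)
    have Bf: "finite (Bf j)" "Bf j \<noteq> {}" "Bf j \<subseteq> U" if "j \<in> ?J" for j
      using that B by (auto simp: Bf_def)
    have Fpos: "F X > 0" if "finite X" "X \<noteq> {}" for X
      using \<mu>1[OF that] that by (simp add: F_def card_gt_0_iff)
    \<comment> \<open>The map \<open>v\<close> may be constant on one of the two sets; induction on
      the sum of the cardinalities only needs it to split the other.\<close>
    have less: "card (Af i) + card (Bf j) < card A + card B" for i j
    proof -
      have "(\<exists>x\<in>A. v x \<noteq> i) \<or> (\<exists>x\<in>B. v x \<noteq> j)" using branch by metis
      then have "Af i \<subset> A \<or> Bf j \<subset> B" unfolding Af_def Bf_def by blast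
      moreover have "Af i \<subseteq> A" "Bf j \<subseteq> B" by (auto simp: Af_def Bf_def)
      ultimately show ?thesis using A(1) B(1)
        by (metis add_le_less_mono add_less_le_mono card_mono psubset_card_mono)
    qed
    have n: "sqrt (F (Af i) * F (Bf j)) \<le> real (card (S (i + j)))" if ij: "i \<in> ?I" "j \<in> ?J" for i j
    proof -
      have "F (Af i) * F (Bf j) \<le> (real (card (Af i + Bf j)))\<^sup>2"
        unfolding F_def using Af[OF ij(1)] Bf[OF ij(2)] less by (intro less.hyps)
      then have "sqrt (F (Af i) * F (Bf j)) \<le> real (card (Af i + Bf j))"
        by (intro real_le_lsqrt) auto
      moreover have "Af i + Bf j \<subseteq> S (i + j)"
        using hom[OF v] by (auto simp: S_def Af_def Bf_def elim!: set_plus_elim)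
      then have "card (Af i + Bf j) \<le> card (S (i + j))"
        using finite_set_plus[OF A(1) B(1)] by (intro card_mono) (auto simp: S_def)
      ultimately show ?thesis by linarith
    qed
    have total: "(\<Sum>k\<in>?I + ?J. real (card (S k))) = real (card (A + B))"
    proof -
      have "v ` (A + B) \<subseteq> ?I + ?J"
        using hom[OF v] by (auto elim!: set_plus_elim intro!: set_plus_intro imageI)
      then have "card (A + B) = (\<Sum>k\<in>?I + ?J. card (S k))"
        unfolding S_def using A B finI
        by (intro card_eq_sum_fibres finite_set_plus)
      then show ?thesis by simp
    qed
    have fibres: "F X \<le> gain (sum (\<lambda>i. F {x \<in> X. v x = i}) (v ` X) / F {x \<in> X. v x = i0}) * F {x \<in> X. v x = i0}"
      if X: "finite X" "X \<noteq> {}" and i0: "i0 \<in> v ` X" for X i0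
    proof -
      let ?f = "\<lambda>i. {x \<in> X. v x = i}"
      have "card X = (\<Sum>i\<in>v ` X. card (?f i))"
        using X by (intro card_eq_sum_fibres) auto
      then have "real (card X) = (\<Sum>i\<in>v ` X. real (card (?f i)))" by simp
      moreover have "(\<Sum>i\<in>v ` X. real (card (?f i))) powr (1 + c) * \<mu> X powr (- c) \<le>
        gain (sum (\<lambda>i. real (card (?f i)) powr (1 + c) * \<mu> (?f i) powr (- c)) (v ` X) /
          (real (card (?f i0)) powr (1 + c) * \<mu> (?f i0) powr (- c))) *
          (real (card (?f i0)) powr (1 + c) * \<mu> (?f i0) powr (- c))"
      proof (rule gain_fibres[OF _ _ _ _ _ \<theta> c \<theta>c i0])
        show "finite (v ` X)" using X by simp
        show "real (card (?f i)) > 0" if "i \<in> v ` X" for i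
          using that X by (auto simp: card_gt_0_iff)
        show "\<mu> (?f i) > 0" if "i \<in> v ` X" for i
          using \<mu>1[of "?f i"] that X by fastforce
        show "\<mu> (?f i) \<le> \<mu> X" for i using X by (intro \<mu>mono) auto
        show "\<theta> * (\<Sum>i\<in>v ` X. \<mu> (?f i)) \<le> \<mu> X" using \<mu>split[OF v X(1)] .
      qed
      ultimately show ?thesis by (simp add: F_def)
    qed
    have ex_max: "\<exists>i0\<in>v ` X. \<forall>i\<in>v ` X. h i \<le> h i0" if "finite X" "X \<noteq> {}" for X and h :: "int \<Rightarrow> real"
      using that Max_in[of "h ` v ` X"] by (metis (no_types, lifting) Max_ge empty_is_image finite_imageI imageE image_eqI)
    obtain i0 where i0: "i0 \<in> ?I" "\<And>i. i \<in> ?I \<Longrightarrow> F (Af i) \<le> F (Af i0)"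
      using ex_max[OF A(1,2), of "\<lambda>i. F (Af i)"] by blast
    obtain j0 where j0: "j0 \<in> ?J" "\<And>j. j \<in> ?J \<Longrightarrow> F (Bf j) \<le> F (Bf j0)"
      using ex_max[OF B(1,2), of "\<lambda>i. F (Bf i)"] by blast
    have FA: "F A \<le> gain (sum (\<lambda>i. F (Af i)) ?I / F (Af i0)) * F (Af i0)"
      unfolding Af_def using i0 by (intro fibres A) (auto simp: Af_def)
    have FB: "F B \<le> gain (sum (\<lambda>i. F (Bf i)) ?J / F (Bf j0)) * F (Bf j0)"
      unfolding Bf_def using j0 by (intro fibres B) (auto simp: Bf_def)
    have "F A * F B \<le> (gain (sum (\<lambda>i. F (Af i)) ?I / F (Af i0)) * F (Af i0)) *
        (gain (sum (\<lambda>i. F (Bf i)) ?J / F (Bf j0)) * F (Bf j0))"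
      using FA FB Fpos[OF A(1,2)] Fpos[OF B(1,2)] by (intro mult_mono) auto
    also have "\<dots> \<le> (\<Sum>k\<in>?I + ?J. real (card (S k)))\<^sup>2"
      using i0 j0 n Fpos[OF Af(1,2)] Fpos[OF Bf(1,2)]
      by (intro sumset_fibres_ge finI) auto
    finally show ?thesis unfolding total F_def .
  qed
qed

subsection \<open>Energies in a group algebra\<close>

abbreviation lookup :: "('a \<Rightarrow>\<^sub>0 'b::zero) \<Rightarrow> 'a \<Rightarrow> 'b" where
  "lookup \<equiv> Poly_Mapping.lookup"

abbreviation keys :: "('a \<Rightarrow>\<^sub>0 'b::zero) \<Rightarrow> 'a set" where
  "keys \<equiv> Poly_Mapping.keys"

section \<open>Convolution, involution and trace\<close>

lemma lookup_single_mult: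
  fixes g :: "'g::ab_group_add \<Rightarrow>\<^sub>0 real"
  shows "lookup (Poly_Mapping.single a c * g) k = c * lookup g (k - a)"
proof -
  have "lookup (Poly_Mapping.single a c) l * Sum_any (\<lambda>q. lookup g q when k = l + q) =
      (c * lookup g (k - a) when l = a)" for l
  proof -
    have "(\<lambda>q. lookup g q when k = l + q) = (\<lambda>q. lookup g q when q = k - l)"
      by (rule ext, rule when_cong) (auto simp: algebra_simps)
    then have "Sum_any (\<lambda>q. lookup g q when k = l + q) = lookup g (k - l)"
      by (simp only: Sum_any_when_equal)
    then show ?thesis
      by (simp add: lookup_single when_def)
  qed
  then show ?thesis by (simp add: lookup_mult)
qed

lemma sum_single_keys:
  "(\<Sum>a\<in>Poly_Mapping.keys f. Poly_Mapping.single a (lookup f a)) = f"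
proof (rule poly_mapping_eqI)
  fix k
  have "lookup (\<Sum>a\<in>keys f. Poly_Mapping.single a (lookup f a)) k =
      (\<Sum>a\<in>keys f. if a = k then lookup f a else 0)"
    by (simp add: lookup_sum lookup_single when_def)
  also have "\<dots> = lookup f k"
    by (simp add: in_keys_iff)
  finally show "lookup (\<Sum>a\<in>keys f. Poly_Mapping.single a (lookup f a)) k = lookup f k" .
qed

lemma lookup_mult_keys:
  fixes f g :: "'g::ab_group_add \<Rightarrow>\<^sub>0 real"
  shows "lookup (f * g) k = (\<Sum>a\<in>keys f. lookup f a * lookup g (k - a))"
proof -
  have "lookup (f * g) k = lookup ((\<Sum>a\<in>keys f. Poly_Mapping.single a (lookup f a)) * g) k"
    by (simp add: sum_single_keys)
  then show ?thesis
    by (simp add: sum_distrib_right lookup_sum lookup_single_mult)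
qed

text \<open>On the Fourier side this is complex conjugation, while the coefficient at
  \<open>0\<close>, called \<open>trace\<close> below, is the integral over the dual group.\<close>

definition star :: "('g::ab_group_add \<Rightarrow>\<^sub>0 real) \<Rightarrow> 'g \<Rightarrow>\<^sub>0 real" where
  "star f = Poly_Mapping.map_key uminus f"

lemma lookup_star [simp]: "lookup (star f) k = lookup f (- k)"
  by (simp add: star_def map_key.rep_eq)

lemma keys_star: "keys (star f) = uminus ` keys f"
proof (rule set_eqI)
  fix k
  have "k \<in> uminus ` keys f \<longleftrightarrow> - k \<in> keys f"
    by (auto intro: image_eqI[of _ _ "- k"])
  then show "k \<in> keys (star f) \<longleftrightarrow> k \<in> uminus ` keys f" by (simp add: in_keys_iff)
qed

lemma star_star [simp]: "star (star f) = f"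
  by (rule poly_mapping_eqI) simp

lemma star_add [simp]: "star (f + g) = star f + star g"
  by (rule poly_mapping_eqI) (simp add: lookup_add)

lemma star_mult [simp]: "star (f * g) = star f * star g"
proof (rule poly_mapping_eqI)
  fix k
  have "lookup (star f * star g) k = (\<Sum>b\<in>uminus ` keys f. lookup f (- b) * lookup g (- (k - b)))"
    by (simp add: lookup_mult_keys keys_star)
  also have "\<dots> = (\<Sum>a\<in>keys f. lookup f a * lookup g (- k - a))"
  proof -
    have "- (k - - a) = - k - a" for a
      by (simp only: diff_conv_add_uminus minus_add_distrib minus_minus)
    then show ?thesis by (simp only: sum.reindex[OF inj_on_subset[OF inj_uminus subset_UNIV]] o_def minus_minus)
  qed
  finally show "lookup (star (f * g)) k = lookup (star f * star g) k"
    by (simp add: lookup_mult_keys)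
qed

lemma star_one [simp]: "star 1 = 1"
  by (rule poly_mapping_eqI) (simp add: lookup_one)

lemma star_power [simp]: "star (f ^ n) = star f ^ n"
  by (induction n) simp_all

lemma star_of_nat [simp]: "star (of_nat n) = of_nat n"
proof (induction n)
  case 0
  show ?case by (rule poly_mapping_eqI) simp
qed simp

abbreviation trace :: "('g::ab_group_add \<Rightarrow>\<^sub>0 real) \<Rightarrow> real" where
  "trace f \<equiv> lookup f 0"

lemma trace_mult: "trace (f * g) = (\<Sum>a\<in>keys f. lookup f a * lookup g (- a))"
  by (simp add: lookup_mult_keys)

lemma trace_mult_star: "trace (f * star f) = (\<Sum>a\<in>keys f. (lookup f a)\<^sup>2)"
  by (simp add: trace_mult power2_eq_square)

lemma trace_mult_star_nonneg: "trace (f * star f) \<ge> 0"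
  by (simp add: trace_mult_star sum_nonneg)

lemma trace_star: "trace (star f) = trace f"
  by simp

lemma trace_Cauchy_Schwarz: "(trace (f * g))\<^sup>2 \<le> trace (f * star f) * trace (g * star g)"
proof -
  have "(trace (f * g))\<^sup>2 \<le> (\<Sum>a\<in>keys f. (lookup f a)\<^sup>2) * (\<Sum>a\<in>keys f. (lookup g (- a))\<^sup>2)"
    unfolding trace_mult by (rule Cauchy_Schwarz_ineq_sum)
  also have "(\<Sum>a\<in>keys f. (lookup g (- a))\<^sup>2) = (\<Sum>b\<in>uminus ` keys f. (lookup g b)\<^sup>2)"
    by (subst sum.reindex) auto
  also have "\<dots> = (\<Sum>b\<in>uminus ` keys f \<inter> keys g. (lookup g b)\<^sup>2)"
    by (rule sum.mono_neutral_right) (auto simp: in_keys_iff)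
  also have "\<dots> \<le> (\<Sum>b\<in>keys g. (lookup g b)\<^sup>2)"
    by (rule sum_mono2) auto
  finally show ?thesis
    by (simp add: trace_mult_star mult_left_mono sum_nonneg)
qed

section \<open>Coefficientwise positivity and order\<close>

definition nonneg :: "('g \<Rightarrow>\<^sub>0 real) \<Rightarrow> bool" where
  "nonneg f \<longleftrightarrow> (\<forall>k. lookup f k \<ge> 0)"

lemma nonneg_add [intro]: "nonneg f \<Longrightarrow> nonneg g \<Longrightarrow> nonneg (f + g)"
  by (simp add: nonneg_def lookup_add)

lemma nonneg_zero [simp]: "nonneg 0"
  by (simp add: nonneg_def)

lemma nonneg_one [simp]: "nonneg 1"
  by (simp add: nonneg_def lookup_one when_def)

lemma nonneg_mult [intro]:
  fixes f g :: "'g::ab_group_add \<Rightarrow>\<^sub>0 real"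
  shows "nonneg f \<Longrightarrow> nonneg g \<Longrightarrow> nonneg (f * g)"
  by (auto simp: nonneg_def lookup_mult_keys intro!: sum_nonneg)

lemma nonneg_power [intro]:
  fixes f :: "'g::ab_group_add \<Rightarrow>\<^sub>0 real"
  shows "nonneg f \<Longrightarrow> nonneg (f ^ n)"
  by (induction n) auto

lemma nonneg_of_nat [simp]: "nonneg (of_nat n :: 'g::ab_group_add \<Rightarrow>\<^sub>0 real)"
  by (induction n) auto

lemma nonneg_star [simp]: "nonneg (star f) \<longleftrightarrow> nonneg f"
  unfolding nonneg_def lookup_star by (metis minus_minus)

lemma nonneg_sum [intro]: "(\<And>i. i \<in> I \<Longrightarrow> nonneg (f i)) \<Longrightarrow> nonneg (sum f I)"
  by (simp add: nonneg_def lookup_sum sum_nonneg)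

lemma nonneg_single [simp]: "nonneg (Poly_Mapping.single a c) \<longleftrightarrow> c \<ge> 0"
  by (auto simp: nonneg_def lookup_single when_def)

definition dominated :: "('g \<Rightarrow>\<^sub>0 real) \<Rightarrow> ('g \<Rightarrow>\<^sub>0 real) \<Rightarrow> bool" (infix \<open>\<preceq>\<close> 50) where
  "f \<preceq> g \<longleftrightarrow> (\<forall>k. lookup f k \<le> lookup g k)"

lemma dominated_trace: "f \<preceq> g \<Longrightarrow> trace f \<le> trace g"
  by (simp add: dominated_def)

lemma dominated_refl [simp]: "f \<preceq> f"
  by (simp add: dominated_def)

lemma dominated_trans [trans]: "f \<preceq> g \<Longrightarrow> g \<preceq> h \<Longrightarrow> f \<preceq> h"
  unfolding dominated_def using order_trans by blast

lemma dominated_add: "f \<preceq> g \<Longrightarrow> f' \<preceq> g' \<Longrightarrow> f + f' \<preceq> g + g'"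
  by (simp add: dominated_def lookup_add add_mono)

lemma dominated_add_right: "nonneg g \<Longrightarrow> f \<preceq> f + g"
  by (simp add: dominated_def nonneg_def lookup_add)

lemma dominated_add_left: "nonneg g \<Longrightarrow> f \<preceq> g + f"
  by (simp add: dominated_def nonneg_def lookup_add)

lemma dominated_nonneg: "f \<preceq> g \<Longrightarrow> nonneg f \<Longrightarrow> nonneg g"
  unfolding dominated_def nonneg_def using order_trans by blast

lemma dominated_mult_right:
  fixes f g h :: "'g::ab_group_add \<Rightarrow>\<^sub>0 real"
  shows "f \<preceq> g \<Longrightarrow> nonneg h \<Longrightarrow> h * f \<preceq> h * g"
  by (auto simp: dominated_def nonneg_def lookup_mult_keys intro!: sum_mono mult_left_mono)

lemma dominated_mult:
  fixes f g f' g' :: "'g::ab_group_add \<Rightarrow>\<^sub>0 real"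
  assumes "f \<preceq> g" "f' \<preceq> g'" "nonneg f" "nonneg f'"
  shows "f * f' \<preceq> g * g'"
proof -
  have "f * f' \<preceq> f * g'" using assms by (simp add: dominated_mult_right)
  moreover have "g' * f \<preceq> g' * g"
    using assms dominated_nonneg by (blast intro: dominated_mult_right)
  ultimately show ?thesis using dominated_trans by (metis mult.commute)
qed

lemma dominated_power:
  fixes f g :: "'g::ab_group_add \<Rightarrow>\<^sub>0 real"
  assumes "f \<preceq> g" "nonneg f"
  shows "f ^ n \<preceq> g ^ n"
  using assms by (induction n) (auto intro: dominated_mult)

lemma dominated_star: "f \<preceq> g \<Longrightarrow> star f \<preceq> star g"
  by (simp add: dominated_def)

section \<open>Energies and Hoelder's inequality\<close>

definition energy :: "nat \<Rightarrow> ('g::ab_group_add \<Rightarrow>\<^sub>0 real) \<Rightarrow> real" where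
  "energy q f = trace (f ^ q * star f ^ q)"

text \<open>On the Fourier side \<open>energy q f\<close> is the integral of the
  \<open>2 * q\<close>-th power of the modulus of \<open>f\<close>; here two of these factors are
  replaced by the modulus of \<open>x\<close>. For the indicator function of a set the energy counts
  pairs of \<open>q\<close>-tuples with equal sums.\<close>

definition mixed_energy ::
    "nat \<Rightarrow> ('g::ab_group_add \<Rightarrow>\<^sub>0 real) \<Rightarrow> ('g \<Rightarrow>\<^sub>0 real) \<Rightarrow> real" where
  "mixed_energy q x f = trace (x * star x * f ^ (q - 1) * star f ^ (q - 1))"

lemma energy_eq_sum: "energy q f = (\<Sum>a\<in>keys (f ^ q). (lookup (f ^ q) a)\<^sup>2)"
  by (simp add: energy_def trace_mult_star[symmetric])

lemma energy_nonneg: "energy q f \<ge> 0"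
  by (simp add: energy_eq_sum sum_nonneg)

text \<open>Log-convexity makes the ratios of consecutive terms nondecreasing, so each is at least
  \<open>D 1 / D 0\<close>, and their product telescopes. The ratios are compared in
  cross-multiplied form.\<close>

lemma log_convex_sequence:
  fixes D :: "nat \<Rightarrow> real"
  assumes nn: "\<And>k. D k \<ge> 0"
    and conv: "\<And>k. Suc k < q \<Longrightarrow> (D (Suc k))\<^sup>2 \<le> D k * D (Suc (Suc k))"
    and q: "q \<ge> 1"
  shows "D 1 ^ q \<le> D 0 ^ (q - 1) * D q"
proof (cases "D 1 = 0")
  case True
  then show ?thesis using q nn by (simp add: zero_power)
next
  case False
  then have D1: "D 1 > 0" using nn[of 1] by linarith
  have ratio: "D (Suc k) > 0 \<and> D 1 * D k \<le> D 0 * D (Suc k)" if "k < q" for k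
    using that
  proof (induction k)
    case 0
    then show ?case using D1 by simp
  next
    case (Suc k)
    then have IH: "D (Suc k) > 0" "D 1 * D k \<le> D 0 * D (Suc k)" by auto
    have c: "(D (Suc k))\<^sup>2 \<le> D k * D (Suc (Suc k))" using conv Suc.prems by blast
    \<comment> \<open>A zero in either place would force \<open>D (Suc k) = 0\<close>.\<close>
    have pos: "D k > 0" "D (Suc (Suc k)) > 0"
      using c IH(1) nn[of k] nn[of "Suc (Suc k)"]
      by (auto simp: less_le)
    have "D k * (D 1 * D (Suc k)) = (D 1 * D k) * D (Suc k)" by simp
    also have "\<dots> \<le> (D 0 * D (Suc k)) * D (Suc k)"
      using IH by (intro mult_right_mono) auto
    also have "\<dots> = D 0 * (D (Suc k))\<^sup>2" by (simp add: power2_eq_square)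
    also have "\<dots> \<le> D 0 * (D k * D (Suc (Suc k)))" using c nn by (intro mult_left_mono) auto
    finally have "D k * (D 1 * D (Suc k)) \<le> D k * (D 0 * D (Suc (Suc k)))"
      by (simp add: algebra_simps)
    then show ?case using pos by simp
  qed
  have "D 1 ^ Suc k \<le> D 0 ^ k * D (Suc k)" if "k < q" for k
    using that
  proof (induction k)
    case (Suc k)
    have "D 1 ^ Suc (Suc k) = D 1 * D 1 ^ Suc k" by simp
    also have "\<dots> \<le> D 1 * (D 0 ^ k * D (Suc k))" using Suc D1 by (intro mult_left_mono) auto
    also have "\<dots> = D 0 ^ k * (D 1 * D (Suc k))" by simp
    also have "\<dots> \<le> D 0 ^ k * (D 0 * D (Suc (Suc k)))"
      using ratio[OF Suc.prems] nn by (intro mult_left_mono) auto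
    finally show ?case by (simp add: algebra_simps)
  qed simp
  from this[of "q - 1"] q show ?thesis by simp
qed

text \<open>Hoelder's inequality without a Fourier transform: the interpolating moments are log-convex by
  Cauchy--Schwarz.\<close>

lemma mixed_energy_le:
  assumes q: "q \<ge> 1"
  shows "mixed_energy q x f ^ q \<le> energy q f ^ (q - 1) * energy q x"
proof -
  define D where "D = (\<lambda>k. trace ((x ^ k * f ^ (q - k)) * star (x ^ k * f ^ (q - k))))"
  have "D 1 ^ q \<le> D 0 ^ (q - 1) * D q"
  proof (rule log_convex_sequence[OF _ _ q])
    show "D k \<ge> 0" for k unfolding D_def by (rule trace_mult_star_nonneg)
  next
    fix k assume k: "Suc k < q"
    then obtain r where r: "q = Suc (Suc k) + r" using less_iff_Suc_add by auto
    \<comment> \<open>The factors are split so that \<open>F * G\<close> has the moment of order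
      \<open>Suc k\<close>, while \<open>F * star F\<close> and \<open>G * star G\<close> have those
      of orders \<open>k\<close> and \<open>k + 2\<close>.\<close>
    define F where "F = x ^ k * f ^ Suc r * star f"
    define G where "G = x * star x ^ Suc k * star f ^ r"
    have "D (Suc k) = trace (F * G)"
      by (simp add: D_def F_def G_def r power_mult_distrib ac_simps)
    moreover have "D k = trace (F * star F)"
      by (simp add: D_def F_def r power_mult_distrib ac_simps)
    moreover have "D (Suc (Suc k)) = trace (G * star G)"
      by (simp add: D_def G_def r power_mult_distrib ac_simps)
    ultimately show "(D (Suc k))\<^sup>2 \<le> D k * D (Suc (Suc k))"
      using trace_Cauchy_Schwarz[of F G] by simp
  qed
  moreover have "D 1 = mixed_energy q x f" "D 0 = energy q f" "D q = energy q x"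
    by (simp_all add: D_def mixed_energy_def energy_def power_mult_distrib ac_simps)
  ultimately show ?thesis by simp
qed

lemma mixed_energy_nonneg: "mixed_energy q x f \<ge> 0"
proof -
  have "mixed_energy q x f = trace ((x * f ^ (q - 1)) * star (x * f ^ (q - 1)))"
    by (simp add: mixed_energy_def ac_simps)
  then show ?thesis by (simp only: trace_mult_star_nonneg)
qed

lemma mixed_energy_mono:
  assumes "nonneg x" "nonneg f" "f \<preceq> g"
  shows "mixed_energy q x f \<le> mixed_energy q x g"
  unfolding mixed_energy_def using assms
  by (intro dominated_trace dominated_mult dominated_power dominated_star nonneg_mult nonneg_power)
    auto

lemma mixed_energy_le_of_energy_le:
  assumes q: "q \<ge> 1" and s: "s \<ge> 0" and x: "energy q x \<le> s ^ q"
  shows "mixed_energy q x f \<le> s * root q (energy q f) ^ (q - 1)"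
proof -
  let ?t = "root q (energy q f)"
  have t: "?t \<ge> 0" "?t ^ q = energy q f" using q energy_nonneg by (auto intro!: real_root_pow_pos2 simp del: real_root_pow_pos2)
  have "mixed_energy q x f ^ q \<le> energy q f ^ (q - 1) * energy q x"
    by (rule mixed_energy_le[OF q])
  also have "\<dots> \<le> energy q f ^ (q - 1) * s ^ q"
    using x by (intro mult_left_mono zero_le_power energy_nonneg)
  also have "energy q f ^ (q - 1) = (?t ^ q) ^ (q - 1)" by (simp only: t(2))
  also have "\<dots> = (?t ^ (q - 1)) ^ q" by (simp only: power_mult[symmetric] mult.commute)
  also have "\<dots> * s ^ q = (s * ?t ^ (q - 1)) ^ q"
    by (simp add: power_mult_distrib)
  finally show ?thesis
    using q s t(1) by (subst (asm) power_mono_iff) (auto simp: mixed_energy_nonneg)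
qed

text \<open>With \<open>t\<close> the \<open>q\<close>-th root of \<open>energy q F\<close>, Hoelder
  turns the hypothesis into \<open>t ^ q \<le> C * sum s I * t ^ (q - 1)\<close>, and a power of
  \<open>t\<close> cancels. As \<open>t\<close> is the square of the \<open>2 * q\<close>-norm, the
  outcome is almost orthogonality with constant \<open>C\<close>.\<close>

lemma root_energy_le:
  assumes q: "q \<ge> 1" and C: "C \<ge> 0" and fin: "finite I"
    and s: "\<And>i. i \<in> I \<Longrightarrow> s i \<ge> 0" and e: "\<And>i. i \<in> I \<Longrightarrow> energy q (f i) \<le> s i ^ q"
    and le: "energy q F \<le> C * (\<Sum>i\<in>I. mixed_energy q (f i) F)"
  shows "energy q F \<le> (C * (\<Sum>i\<in>I. s i)) ^ q"
proof -
  let ?t = "root q (energy q F)"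
  have t: "?t \<ge> 0" "?t ^ q = energy q F" using q energy_nonneg by (auto intro!: real_root_pow_pos2 simp del: real_root_pow_pos2)
  have nn: "C * sum s I \<ge> 0" using C s by (simp add: sum_nonneg)
  show ?thesis
  proof (cases "?t = 0")
    case True
    then have "energy q F = 0" using t(2) q by (simp add: zero_power)
    then show ?thesis using nn by simp
  next
    case False
    then have tp: "?t > 0" using t by linarith
    have "?t * ?t ^ (q - 1) = energy q F" using t(2) q by (metis power_eq_if not_one_le_zero)
    also have "\<dots> \<le> C * (\<Sum>i\<in>I. s i * ?t ^ (q - 1))"
      using le C mixed_energy_le_of_energy_le[OF q s e]
      by (meson mult_left_mono order_trans sum_mono)
    also have "\<dots> = (C * sum s I) * ?t ^ (q - 1)" by (simp add: sum_distrib_right)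
    finally have "?t \<le> C * sum s I" using tp by (simp add: mult_le_cancel_right)
    from power_mono[OF this t(1), of q] show ?thesis by (simp only: t(2))
  qed
qed

text \<open>Without orthogonality, Cauchy--Schwarz is used twice: for each \<open>f i\<close>
  against the \<open>q\<close>-th power of the sum, and then over the index set, which costs
  \<open>card I\<close>.\<close>

lemma energy_sum_le:
  assumes q: "q \<ge> 1" and fin: "finite I" and nn: "\<And>i. i \<in> I \<Longrightarrow> nonneg (f i)"
  shows "energy q (sum f I) \<le> real (card I) * (\<Sum>i\<in>I. mixed_energy q (f i) (sum f I))"
proof -
  let ?F = "sum f I"
  let ?T = "energy q ?F"
  have F: "nonneg ?F" using nn by auto
  have le: "trace (f i * ?F ^ (q - 1) * star ?F ^ q) \<le> sqrt (mixed_energy q (f i) ?F) * sqrt ?T"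
    if "i \<in> I" for i
  proof -
    have "(trace ((f i * ?F ^ (q - 1)) * star ?F ^ q))\<^sup>2 \<le>
        trace ((f i * ?F ^ (q - 1)) * star (f i * ?F ^ (q - 1))) *
        trace (star ?F ^ q * star (star ?F ^ q))"
      by (rule trace_Cauchy_Schwarz)
    also have "\<dots> = mixed_energy q (f i) ?F * ?T"
      by (simp add: mixed_energy_def energy_def ac_simps)
    finally show ?thesis
      by (metis real_le_rsqrt real_sqrt_mult)
  qed
  have "?T = trace ((\<Sum>i\<in>I. f i) * ?F ^ (q - 1) * star ?F ^ q)"
    unfolding energy_def using q by (metis power_eq_if not_one_le_zero)
  also have "\<dots> = (\<Sum>i\<in>I. trace (f i * ?F ^ (q - 1) * star ?F ^ q))"
    unfolding sum_distrib_right lookup_sum ..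
  also have "\<dots> \<le> (\<Sum>i\<in>I. sqrt (mixed_energy q (f i) ?F) * sqrt ?T)"
    using le by (rule sum_mono)
  also have "\<dots> = (\<Sum>i\<in>I. sqrt (mixed_energy q (f i) ?F)) * sqrt ?T"
    by (simp add: sum_distrib_right)
  finally have *: "?T \<le> (\<Sum>i\<in>I. sqrt (mixed_energy q (f i) ?F)) * sqrt ?T" .
  show ?thesis
  proof (cases "?T = 0")
    case True
    then show ?thesis by (simp add: sum_nonneg mixed_energy_nonneg)
  next
    case False
    then have "?T > 0" using energy_nonneg[of q ?F] by linarith
    then have "sqrt ?T * sqrt ?T \<le> (\<Sum>i\<in>I. sqrt (mixed_energy q (f i) ?F)) * sqrt ?T"
      using * by simp
    then have "sqrt ?T \<le> (\<Sum>i\<in>I. sqrt (mixed_energy q (f i) ?F))"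
      using \<open>?T > 0\<close> by (subst (asm) mult_le_cancel_right_pos) simp_all
    then have "?T \<le> (\<Sum>i\<in>I. 1 * sqrt (mixed_energy q (f i) ?F))\<^sup>2"
      using sqrt_le_D by simp
    also have "\<dots> \<le> (\<Sum>i\<in>I. 1\<^sup>2) * (\<Sum>i\<in>I. (sqrt (mixed_energy q (f i) ?F))\<^sup>2)"
      by (rule Cauchy_Schwarz_ineq_sum)
    finally show ?thesis by (simp add: mixed_energy_nonneg)
  qed
qed

section \<open>Almost orthogonality\<close>

lemma binomial_remainder:
  fixes x y :: "'g::ab_group_add \<Rightarrow>\<^sub>0 real"
  assumes "nonneg x" "nonneg y"
  shows "\<exists>Q. nonneg Q \<and> Q \<preceq> of_nat ((n + 2)\<^sup>2) * (x + y) ^ n \<and>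
    (x + y) ^ (n + 2) = y ^ (n + 2) + of_nat (n + 2) * (x * y ^ (n + 1)) + x\<^sup>2 * Q"
proof (induction n)
  case 0
  have "(x + y) ^ (0 + 2) = y ^ (0 + 2) + of_nat (0 + 2) * (x * y ^ (0 + 1)) + x\<^sup>2 * 1"
    by (simp add: power2_eq_square algebra_simps)
  moreover have "1 \<preceq> of_nat ((0 + 2)\<^sup>2) * (x + y) ^ 0"
    using dominated_add_right[of "of_nat 3" "1 :: 'g \<Rightarrow>\<^sub>0 real"] nonneg_of_nat[of 3]
    by (simp del: nonneg_of_nat)
  ultimately show ?case using nonneg_one by blast
next
  case (Suc n)
  then obtain Q where Q: "nonneg Q" "Q \<preceq> of_nat ((n + 2)\<^sup>2) * (x + y) ^ n"
    "(x + y) ^ (n + 2) = y ^ (n + 2) + of_nat (n + 2) * (x * y ^ (n + 1)) + x\<^sup>2 * Q"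
    by blast
  let ?Q = "(x + y) * Q + of_nat (n + 2) * y ^ (n + 1)"
  have xy: "nonneg (x + y)" using assms by auto
  have nn: "nonneg ?Q" by (intro nonneg_add nonneg_mult nonneg_power nonneg_of_nat assms Q(1))
  have "(x + y) ^ (Suc n + 2) = (x + y) * (x + y) ^ (n + 2)" by simp
  also have "\<dots> = y ^ (Suc n + 2) + of_nat (Suc n + 2) * (x * y ^ (Suc n + 1)) + x\<^sup>2 * ?Q"
    unfolding Q(3) by (simp add: power2_eq_square algebra_simps)
  finally have eq: "(x + y) ^ (Suc n + 2) =
      y ^ (Suc n + 2) + of_nat (Suc n + 2) * (x * y ^ (Suc n + 1)) + x\<^sup>2 * ?Q" .
  have "(x + y) * Q \<preceq> (x + y) * (of_nat ((n + 2)\<^sup>2) * (x + y) ^ n)"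
    using Q(2) xy by (rule dominated_mult_right)
  moreover have "of_nat (n + 2) * y ^ (n + 1) \<preceq> of_nat (n + 2) * (x + y) ^ (n + 1)"
    by (intro dominated_mult_right dominated_power dominated_add_left nonneg_of_nat assms)
  ultimately have "?Q \<preceq> (x + y) * (of_nat ((n + 2)\<^sup>2) * (x + y) ^ n) +
      of_nat (n + 2) * (x + y) ^ (n + 1)"
    by (rule dominated_add)
  also have "\<dots> = of_nat ((n + 2)\<^sup>2 + (n + 2)) * (x + y) ^ (Suc n)"
    by (simp add: algebra_simps)
  \<comment> \<open>Padding by \<open>n + 3\<close> completes the coefficient to the square of
    \<open>n + 3\<close>.\<close>
  also have "\<dots> \<preceq> \<dots> + of_nat (n + 3) * (x + y) ^ Suc n"
    by (intro dominated_add_right nonneg_mult nonneg_power nonneg_of_nat xy)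
  also have "\<dots> = of_nat ((Suc n + 2)\<^sup>2) * (x + y) ^ Suc n"
    unfolding distrib_right[symmetric] of_nat_add[symmetric]
    by (rule arg_cong[where f = "\<lambda>m. of_nat m * _"]) (simp add: power2_eq_square)
  finally show ?case using nn eq by blast
qed

text \<open>Expand \<open>(x + y) ^ q\<close> as \<open>Z0 + Z1 + R\<close> by order in
  \<open>x\<close>. In the energy the terms of first order vanish by \<open>orth\<close>; what
  remains beyond \<open>energy q y\<close> has at least two factors from \<open>x\<close> or
  \<open>star x\<close> and splits into three parts, each at most \<open>real (q\<^sup>2)\<close>
  times the mixed energy.\<close>

lemma energy_add_le:
  fixes x y :: "'g::ab_group_add \<Rightarrow>\<^sub>0 real"
  assumes q: "q \<ge> 2" and x: "nonneg x" and y: "nonneg y"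
    and orth: "trace (x * y ^ (q - 1) * star y ^ q) = 0"
  shows "energy q (x + y) \<le> energy q y + 3 * real (q\<^sup>2) * mixed_energy q x (x + y)"
proof -
  obtain n where n: "q = n + 2" using q by (metis add.commute le_Suc_ex)
  let ?f = "x + y"
  have f: "nonneg ?f" using x y by auto
  obtain Q where Q: "nonneg Q" "Q \<preceq> of_nat (q\<^sup>2) * ?f ^ n"
    "?f ^ q = y ^ q + of_nat q * (x * y ^ (n + 1)) + x\<^sup>2 * Q"
    using binomial_remainder[OF x y, of n] n by auto
  define Z0 where "Z0 = y ^ q"
  define Z1 where "Z1 = of_nat q * (x * y ^ (n + 1))"
  define R where "R = x\<^sup>2 * Q"
  have nn: "nonneg Z0" "nonneg Z1" "nonneg R"
    unfolding Z0_def Z1_def R_def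
    by (intro nonneg_mult nonneg_power nonneg_of_nat x y Q(1))+
  have Z: "?f ^ q = Z0 + Z1 + R" by (simp add: Q(3) Z0_def Z1_def R_def)
  have tr: "trace (of_nat m * F) = real m * trace F" for m and F :: "'g \<Rightarrow>\<^sub>0 real"
    by (induction m) (auto simp: algebra_simps lookup_add)
  let ?D = "mixed_energy q x ?f"
  have q1: "q - 1 = n + 1" using n by simp
  have "Z1 * star Z0 = of_nat q * (x * y ^ (q - 1) * star y ^ q)"
    by (simp only: Z1_def Z0_def q1 star_power mult.assoc)
  then have "trace (Z1 * star Z0) = 0" using orth by (simp only: tr mult_zero_right)
  moreover have "trace (Z0 * star Z1) = trace (Z1 * star Z0)"
    using trace_star[of "Z1 * star Z0"] by (simp only: star_mult star_star mult.commute)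
  moreover have "trace (Z1 * star Z1) \<le> real (q\<^sup>2) * ?D"
  proof -
    have "Z1 * star Z1 = of_nat q * (of_nat q * (x * star x * y ^ (q - 1) * star y ^ (q - 1)))"
      unfolding Z1_def q1 star_mult star_power star_of_nat by (simp only: ac_simps)
    then have "trace (Z1 * star Z1) = real (q\<^sup>2) * mixed_energy q x y"
      by (simp only: tr mixed_energy_def) (simp add: power2_eq_square)
    also have "\<dots> \<le> real (q\<^sup>2) * ?D"
      using x y by (intro mult_left_mono mixed_energy_mono dominated_add_left) auto
    finally show ?thesis .
  qed
  moreover have "trace (R * star ?f ^ q) \<le> real (q\<^sup>2) * ?D"
  proof -
    \<comment> \<open>Both copies of \<open>x\<close> stand without a star, so this is not yet a
      mixed energy. The factors are chosen so that \<open>?A * star ?A\<close> and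
      \<open>?B * star ?B\<close> are both the element whose trace is the mixed energy, and
      Cauchy--Schwarz applies.\<close>
    let ?A = "x * ?f ^ n * star ?f" and ?B = "x * star ?f ^ (n + 1)"
    have alg: "x\<^sup>2 * (c * a ^ n) * b ^ q = c * ((x * a ^ n * b) * (x * b ^ (n + 1)))"
      for a b c :: "'g \<Rightarrow>\<^sub>0 real"
      by (simp add: n power2_eq_square ac_simps)
    have "trace (R * star ?f ^ q) \<le> trace ((x\<^sup>2 * (of_nat (q\<^sup>2) * ?f ^ n)) * star ?f ^ q)"
      unfolding R_def using Q(1,2) x f
      by (intro dominated_trace dominated_mult[OF _ dominated_refl] dominated_mult_right nonneg_mult
          nonneg_power) (simp_all only: nonneg_star)
    also have "\<dots> = real (q\<^sup>2) * trace (?A * ?B)"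
      by (simp only: alg tr)
    also have "trace (?A * ?B) \<le> ?D"
    proof -
      have "?A * star ?A = x * star x * ?f ^ (q - 1) * star ?f ^ (q - 1)"
        unfolding q1 star_mult star_star star_power by (simp add: ac_simps del: star_add)
      moreover have "?B * star ?B = x * star x * ?f ^ (q - 1) * star ?f ^ (q - 1)"
        unfolding q1 star_mult star_star star_power by (simp only: ac_simps)
      ultimately have "(trace (?A * ?B))\<^sup>2 \<le> ?D\<^sup>2"
        using trace_Cauchy_Schwarz[of ?A ?B]
        by (simp only: mixed_energy_def power2_eq_square)
      then show ?thesis
        using mixed_energy_nonneg by (rule power2_le_imp_le)
    qed
    finally show ?thesis by (simp add: mult_left_mono)
  qed
  \<comment> \<open>\<open>Z0 + Z1\<close> is dominated by the full power, which reduces this term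
    to the previous one by invariance of the trace under \<open>star\<close>.\<close>
  moreover have "trace ((Z0 + Z1) * star R) \<le> trace (R * star ?f ^ q)"
  proof -
    have "trace ((Z0 + Z1) * star R) \<le> trace (?f ^ q * star R)"
      unfolding Z using nn by (intro dominated_trace dominated_mult dominated_add_right) auto
    also have "\<dots> = trace (R * star ?f ^ q)"
      using trace_star[of "R * star ?f ^ q"]
      by (simp only: star_mult star_star star_power mult.commute)
    finally show ?thesis .
  qed
  moreover have "energy q ?f = trace (Z0 * star Z0) + trace (Z1 * star Z0) + trace (Z0 * star Z1) +
      trace (Z1 * star Z1) + trace (R * star ?f ^ q) + trace ((Z0 + Z1) * star R)"
  proof -
    have "?f ^ q * star ?f ^ q = Z0 * star Z0 + Z1 * star Z0 + Z0 * star Z1 +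
      Z1 * star Z1 + R * star ?f ^ q + (Z0 + Z1) * star R"
    proof -
      have "star ?f ^ q = star Z0 + star Z1 + star R"
        using arg_cong[OF Z, of star] by (simp only: star_power star_add)
      then show ?thesis by (simp only: Z) (simp only: algebra_simps)
    qed
    then show ?thesis unfolding energy_def by (simp only: lookup_add)
  qed
  moreover have "trace (Z0 * star Z0) = energy q y"
    by (simp add: Z0_def energy_def)
  ultimately show ?thesis by linarith
qed

text \<open>Peel off the summand of least \<open>m\<close>: against the sum of those above it, the
  orthogonality hypothesis removes the first-order terms. Nonnegativity allows the mixed energy with
  a partial sum to be replaced by that with the whole.\<close>

lemma energy_sum_orthogonal_le:
  fixes f :: "'i \<Rightarrow> 'g::ab_group_add \<Rightarrow>\<^sub>0 real" and m :: "'i \<Rightarrow> int"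
  assumes q: "q \<ge> 2" and fin: "finite J" and inj: "inj_on m J"
    and nn: "\<And>j. j \<in> J \<Longrightarrow> nonneg (f j)"
    and orth: "\<And>j J'. j \<in> J \<Longrightarrow> J' \<subseteq> {i \<in> J. m i > m j} \<Longrightarrow>
      trace (f j * sum f J' ^ (q - 1) * star (sum f J') ^ q) = 0"
  shows "energy q (sum f J) \<le> 3 * real (q\<^sup>2) * (\<Sum>j\<in>J. mixed_energy q (f j) (sum f J))"
proof -
  let ?F = "sum f J"
  have "energy q (sum f I) \<le> 3 * real (q\<^sup>2) * (\<Sum>j\<in>I. mixed_energy q (f j) ?F)" if "I \<subseteq> J" for I
    using finite_subset[OF that fin] that
  proof (induction "card I" arbitrary: I)
    case 0
    then show ?case using q by (simp add: energy_def zero_power)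
  next
    case (Suc n)
    then have ne: "I \<noteq> {}" by auto
    define j where "j = arg_min_on m I"
    have j: "j \<in> I" and min: "\<And>i. i \<in> I \<Longrightarrow> m j \<le> m i"
      using arg_min_if_finite[OF \<open>finite I\<close> ne, of m] unfolding j_def by (blast, meson not_less)
    let ?I = "I - {j}"
    have gt: "?I \<subseteq> {i \<in> J. m i > m j}"
    proof
      fix i assume i: "i \<in> ?I"
      then have "m i \<noteq> m j" using inj_onD[OF inj] j Suc.prems(2) by blast
      then show "i \<in> {i \<in> J. m i > m j}" using min[of i] i Suc.prems(2) by auto
    qed
    have I: "sum f I = f j + sum f ?I"
      using j Suc.prems(1) by (simp add: sum.remove)
    have nnI: "nonneg (f j)" "nonneg (sum f ?I)" "nonneg (sum f I)"
      using nn j Suc.prems(2) by (auto intro!: nonneg_sum)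
    have "energy q (f j + sum f ?I) \<le>
        energy q (sum f ?I) + 3 * real (q\<^sup>2) * mixed_energy q (f j) (f j + sum f ?I)"
      using subsetD[OF Suc.prems(2) j] gt by (intro energy_add_le[OF q nnI(1,2)] orth)
    also have "mixed_energy q (f j) (f j + sum f ?I) \<le> mixed_energy q (f j) ?F"
      unfolding I[symmetric]
    proof (rule mixed_energy_mono[OF nnI(1,3)])
      have "?F = sum f I + sum f (J - I)"
        using sum.subset_diff[OF Suc.prems(2) fin, of f] by (simp add: add.commute)
      moreover have "nonneg (sum f (J - I))" using nn by (intro nonneg_sum) auto
      ultimately show "sum f I \<preceq> ?F" using dominated_add_right by metis
    qed
    also have "energy q (sum f ?I) \<le> 3 * real (q\<^sup>2) * (\<Sum>j\<in>?I. mixed_energy q (f j) ?F)"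
      using Suc.hyps(2) Suc.prems j by (intro Suc.hyps(1)) auto
    finally have "energy q (sum f I) \<le> 3 * real (q\<^sup>2) * (\<Sum>j\<in>?I. mixed_energy q (f j) ?F) +
        3 * real (q\<^sup>2) * mixed_energy q (f j) ?F"
      by (simp add: I mult_left_mono)
    then show ?case
      using j Suc.prems(1) by (simp add: sum.remove algebra_simps)
  qed
  then show ?thesis by blast
qed

subsection \<open>Valuations of rational numbers\<close>

text \<open>The \<open>p\<close>-adic valuation of a nonzero rational. At \<open>0\<close> its value
  is \<open>0\<close> instead of infinity, so zero is treated separately in what follows.\<close>

definition rval :: "nat \<Rightarrow> rat \<Rightarrow> int" where
  "rval p x = int (multiplicity (int p) (fst (quotient_of x))) -
    int (multiplicity (int p) (snd (quotient_of x)))"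

lemma rval_Fract:
  assumes p: "prime p" and ab: "a \<noteq> 0" "b \<noteq> 0"
  shows "rval p (Fract a b) = int (multiplicity (int p) a) - int (multiplicity (int p) b)"
proof -
  obtain c d where cd: "quotient_of (Fract a b) = (c, d)" by fastforce
  then have d: "d > 0" and eq: "Fract a b = Fract c d"
    using quotient_of_denom_pos[OF cd] quotient_of_div[OF cd] by (auto simp: Fract_of_int_quotient)
  then have ad: "a * d = c * b" using ab by (simp add: eq_rat)
  then have c: "c \<noteq> 0" using ab d by auto
  have P: "prime_elem (int p)" using p by simp
  have "multiplicity (int p) a + multiplicity (int p) d = multiplicity (int p) c + multiplicity (int p) b"
    using arg_cong[OF ad, of "multiplicity (int p)"] P ab c d
    by (simp add: prime_elem_multiplicity_mult_distrib)
  then show ?thesis by (simp add: rval_def cd)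
qed

lemma rval_mult:
  assumes p: "prime p" and "x \<noteq> 0" "y \<noteq> 0"
  shows "rval p (x * y) = rval p x + rval p y"
proof -
  obtain a b where x: "x = Fract a b" "b > 0" by (cases x) auto
  obtain c d where y: "y = Fract c d" "d > 0" by (cases y) auto
  have nz: "a \<noteq> 0" "c \<noteq> 0" using x y assms by (auto simp: Zero_rat_def eq_rat)
  have "prime_elem (int p)" using p by simp
  then show ?thesis
    using x y nz by (simp add: rval_Fract[OF p] prime_elem_multiplicity_mult_distrib)
qed

lemma rval_one: "prime p \<Longrightarrow> rval p 1 = 0"
  by (simp add: rval_def)

lemma rval_power:
  assumes "prime p" "x \<noteq> 0"
  shows "rval p (x ^ n) = int n * rval p x"
  using assms by (induction n) (auto simp: rval_one rval_mult algebra_simps)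

lemma rval_inverse:
  assumes "prime p" "x \<noteq> 0"
  shows "rval p (inverse x) = - rval p x"
  using rval_mult[OF assms(1,2), of "inverse x"] assms by (simp add: rval_one)

lemma rval_divide:
  assumes "prime p" "x \<noteq> 0" "y \<noteq> 0"
  shows "rval p (x / y) = rval p x - rval p y"
  using assms by (simp add: divide_inverse rval_mult rval_inverse)

lemma rval_minus: "rval p (- x) = rval p x"
  by (cases "quotient_of x") (simp add: rval_def rat_uminus_code)

lemma rval_add_ge:
  assumes p: "prime p" and nz: "x \<noteq> 0" "y \<noteq> 0" "x + y \<noteq> 0"
    and k: "k \<le> rval p x" "k \<le> rval p y"
  shows "k \<le> rval p (x + y)"
proof -
  obtain a b where x: "x = Fract a b" "b > 0" by (cases x) auto
  obtain c d where y: "y = Fract c d" "d > 0" by (cases y) auto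
  let ?q = "int p" and ?b = "b * d" and ?a = "a * d" and ?c = "c * b"
  have x': "x = Fract ?a ?b" and y': "y = Fract ?c ?b" and s: "x + y = Fract (?a + ?c) ?b"
    using x y by (simp_all add: eq_rat)
  have nz': "?a \<noteq> 0" "?c \<noteq> 0" "?a + ?c \<noteq> 0" "?b \<noteq> 0"
    using nz x y unfolding x' y' s by (auto simp: Zero_rat_def eq_rat)
  define n where "n = min (multiplicity ?q ?a) (multiplicity ?q ?c)"
  have "?q ^ n dvd ?a" "?q ^ n dvd ?c" by (auto simp: n_def multiplicity_dvd')
  then have "?q ^ n dvd ?a + ?c" by (rule dvd_add)
  moreover have "\<not> is_unit ?q" using p prime_gt_1_nat[OF p] by simp
  ultimately have "n \<le> multiplicity ?q (?a + ?c)"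
    using nz' by (simp add: power_dvd_iff_le_multiplicity)
  then show ?thesis
    using k unfolding s unfolding x' y' using nz' by (simp add: rval_Fract[OF p] n_def min_def split: if_splits)
qed

lemma rval_sum_ge:
  assumes p: "prime p" and fin: "finite S"
    and k: "\<And>s. s \<in> S \<Longrightarrow> f s \<noteq> 0 \<Longrightarrow> k \<le> rval p (f s)" and nz: "sum f S \<noteq> 0"
  shows "k \<le> rval p (sum f S)"
  using fin k nz
proof (induction S)
  case (insert s S)
  show ?case
  proof (cases "f s = 0 \<or> sum f S = 0")
    case True
    then show ?thesis using insert by auto
  next
    case False
    then have "k \<le> rval p (f s)" "k \<le> rval p (sum f S)" using insert by auto
    then show ?thesis using insert False by (simp add: rval_add_ge[OF p])
  qed
qed simp

lemma rval_add_eq: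
  assumes p: "prime p" and x: "x \<noteq> 0" and y: "y = 0 \<or> rval p x < rval p y"
  shows "x + y \<noteq> 0" "rval p (x + y) = rval p x"
proof -
  show nz: "x + y \<noteq> 0" using x y rval_minus[of p x] by (auto simp: add_eq_0_iff)
  show "rval p (x + y) = rval p x"
  proof (cases "y = 0")
    case False
    have "rval p x \<le> rval p (x + y)" using y x nz False by (intro rval_add_ge[OF p]) auto
    \<comment> \<open>Otherwise \<open>x\<close>, as the difference of \<open>x + y\<close> and
      \<open>y\<close>, would have a valuation larger than its own.\<close>
    moreover have "\<not> rval p x + 1 \<le> rval p (x + y)"
    proof
      assume "rval p x + 1 \<le> rval p (x + y)"
      then have "rval p x + 1 \<le> rval p ((x + y) + (- y))"
        using rval_add_ge[OF p, of "x + y" "- y" "rval p x + 1"] y x nz False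
        by (simp add: rval_minus)
      then show False by simp
    qed
    ultimately show ?thesis by linarith
  qed simp
qed

text \<open>Unique factorisation after clearing denominators. Valuations do not see the sign, hence
  the restriction to positive rationals.\<close>

lemma rval_separates:
  assumes "x > 0" "y > 0" and eq: "\<And>p. prime p \<Longrightarrow> rval p x = rval p y"
  shows "x = y"
proof -
  obtain a b where x: "x = Fract a b" "b > 0" by (cases x) auto
  obtain c d where y: "y = Fract c d" "d > 0" by (cases y) auto
  have pos: "a > 0" "c > 0" using x y assms by (auto simp: zero_less_Fract_iff)
  have "a * d = c * b"
  proof (rule multiplicity_eq_int)
    show "a * d > 0" "c * b > 0" using x y pos by auto
    fix q :: int assume q: "prime q"
    then obtain p where p: "q = int p" "prime p"
      by (metis int_nat_eq nat_0_le prime_ge_0_int prime_nat_int_transfer)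
    have "prime_elem (int p)" using p by simp
    then show "multiplicity q (a * d) = multiplicity q (c * b)"
      using eq[OF p(2)] x y pos
      by (simp add: p(1) rval_Fract[OF p(2)] prime_elem_multiplicity_mult_distrib)
  qed
  then show ?thesis using x y by (simp add: eq_rat)
qed

text \<open>The multiplicative group of the rationals, written additively so that its group algebra is an
  instance of \<^typ>\<open>'a \<Rightarrow>\<^sub>0 'b\<close>.\<close>

typedef nzrat = "{x :: rat. x \<noteq> 0}"
  morphisms rat_of nz
  by (rule exI[of _ 1]) simp

setup_lifting type_definition_nzrat

instantiation nzrat :: ab_group_add
begin

lift_definition zero_nzrat :: nzrat is 1 by simp
lift_definition plus_nzrat :: "nzrat \<Rightarrow> nzrat \<Rightarrow> nzrat" is "(*)" by simp
lift_definition minus_nzrat :: "nzrat \<Rightarrow> nzrat \<Rightarrow> nzrat" is "(/)" by simp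
lift_definition uminus_nzrat :: "nzrat \<Rightarrow> nzrat" is inverse by simp

instance
  by standard (transfer; simp add: field_simps)+

end

lemma rat_of_nonzero [simp]: "rat_of a \<noteq> 0"
  using rat_of by simp

lemma rat_of_nz [simp]: "x \<noteq> 0 \<Longrightarrow> rat_of (nz x) = x"
  by (simp add: nz_inverse)

lemmas rat_of_simps = zero_nzrat.rep_eq plus_nzrat.rep_eq minus_nzrat.rep_eq uminus_nzrat.rep_eq

subsection \<open>Polynomial graphs at a prime\<close>

lemma keys_mult_closed:
  fixes f g :: "'g::ab_group_add \<Rightarrow>\<^sub>0 real"
  assumes "h \<in> keys (f * g)"
  obtains a b where "h = a + b" "a \<in> keys f" "b \<in> keys g"
  using assms keys_mult[of f g] by blast

lemma trace_mult_star_disjoint: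
  assumes "keys f \<inter> keys g = {}"
  shows "trace (f * star g) = 0"
proof -
  have "lookup f a * lookup g a = 0" if "a \<in> keys f" for a
    using assms that by (auto simp: in_keys_iff)
  then have "(\<Sum>a\<in>keys f. lookup f a * lookup g a) = 0" by (intro sum.neutral) blast
  then show ?thesis by (simp add: trace_mult)
qed

section \<open>Units close to one for a prime\<close>

lemma rval_unit:
  assumes p: "prime p" and u: "u = 1 \<or> rval p (u - 1) > 0"
  shows "u \<noteq> 0" "rval p u = 0"
proof -
  have "u - 1 = 0 \<or> rval p 1 < rval p (u - 1)" using u rval_one[OF p] by auto
  from rval_add_eq[OF p, of 1, OF _ this] show "u \<noteq> 0" "rval p u = 0"
    using rval_one[OF p] by auto
qed

text \<open>Such elements form the group of units congruent to \<open>1\<close> beyond level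
  \<open>m\<close>; closure follows from \<open>u * w - 1 = u * (w - 1) + (u - 1)\<close>.\<close>

lemma rval_unit_mult:
  assumes p: "prime p" and m: "m \<ge> 0"
    and u: "u = 1 \<or> rval p (u - 1) > m" and w: "w = 1 \<or> rval p (w - 1) > m"
  shows "u * w = 1 \<or> rval p (u * w - 1) > m"
proof (cases "u = 1 \<or> w = 1 \<or> u * w = 1")
  case True
  then show ?thesis using u w by auto
next
  case False
  have ru: "u \<noteq> 0" "rval p u = 0" using rval_unit[OF p, of u] u m by auto
  have eq: "u * w - 1 = u * (w - 1) + (u - 1)" by (simp add: algebra_simps)
  have "m + 1 \<le> rval p (u * w - 1)"
    unfolding eq
  proof (rule rval_add_ge[OF p])
    show "u * (w - 1) \<noteq> 0" "u - 1 \<noteq> 0" "u * (w - 1) + (u - 1) \<noteq> 0"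
      using False ru eq by auto
    show "m + 1 \<le> rval p (u * (w - 1))" "m + 1 \<le> rval p (u - 1)"
      using False ru u w by (auto simp: rval_mult[OF p])
  qed
  then show ?thesis by simp
qed

text \<open>In the same expansion of \<open>u * w - 1\<close> only the term \<open>u - 1\<close>
  reaches down to level \<open>m\<close>, so it cannot be cancelled.\<close>

lemma rval_unit_mult_eq:
  assumes p: "prime p" and m: "m > 0"
    and u: "u \<noteq> 1" "rval p (u - 1) = m" and w: "w = 1 \<or> rval p (w - 1) > m"
  shows "u * w \<noteq> 1 \<and> rval p (u * w - 1) = m"
proof -
  have ru: "u \<noteq> 0" "rval p u = 0" using rval_unit[OF p, of u] u m by auto
  have eq: "u * w - 1 = (u - 1) + u * (w - 1)" by (simp add: algebra_simps)
  have "u - 1 \<noteq> 0" using u by simp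
  moreover have "u * (w - 1) = 0 \<or> rval p (u - 1) < rval p (u * (w - 1))"
    using w ru u by (cases "w = 1") (auto simp: rval_mult[OF p])
  ultimately show ?thesis using rval_add_eq[OF p, of "u - 1" "u * (w - 1)"] u unfolding eq[symmetric]
    by auto
qed

text \<open>An element with first nontrivial \<open>p\<close>-adic digit in position \<open>m\<close> is not cancelled by elements
  that are trivial up to position \<open>m\<close>.\<close>

lemma trace_eq_zero_of_rval:
  fixes x y :: "nzrat \<times> nzrat \<Rightarrow>\<^sub>0 real" and c :: rat and k :: nat
  assumes p: "prime p" and c: "c \<noteq> 0" and m: "m > 0" and q: "q \<ge> 1"
  defines "D \<equiv> \<lambda>n h. rat_of (snd h) / (c ^ n * rat_of (fst h) ^ k)"
  assumes x: "\<And>h. h \<in> keys x \<Longrightarrow> D 1 h \<noteq> 1 \<and> rval p (D 1 h - 1) = m"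
    and y: "\<And>h. h \<in> keys y \<Longrightarrow> D 1 h = 1 \<or> rval p (D 1 h - 1) > m"
  shows "trace (x * y ^ (q - 1) * star y ^ q) = 0"
proof -
  \<comment> \<open>\<open>D n\<close> compares a sum of \<open>n\<close> elements with the graph of
    the monomial \<open>c * X ^ k\<close>. It turns addition in the group into multiplication of
    rationals, and the power \<open>c ^ n\<close> keeps track of the number of summands.\<close>
  have D: "D (n + n') (h + h') = D n h * D n' h'" for n n' h h'
    by (simp add: D_def rat_of_simps power_add power_mult_distrib)
  have yn: "D n h = 1 \<or> rval p (D n h - 1) > m" if "h \<in> keys (y ^ n)" for n h
    using that
  proof (induction n arbitrary: h)
    case 0
    then have "h = 0" by simp
    then show ?case by (simp add: D_def rat_of_simps)
  next
    case (Suc n)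
    then have "h \<in> keys (y * y ^ n)" by simp
    then obtain a b where ab: "h = a + b" "a \<in> keys y" "b \<in> keys (y ^ n)" by (rule keys_mult_closed)
    show ?case
      using rval_unit_mult[OF p _ y[OF ab(2)] Suc.IH[OF ab(3)]] m D[of 1 n a b] ab(1) by simp
  qed
  \<comment> \<open>One factor from \<open>x\<close> fixes the level of the product at exactly
    \<open>m\<close>, whereas \<open>q\<close> factors from \<open>y\<close> give \<open>1\<close>
    or stay above \<open>m\<close>; so no element arises in both ways.\<close>
  have "keys (x * y ^ (q - 1)) \<inter> keys (y ^ q) = {}"
  proof (intro equals0I)
    fix h assume h: "h \<in> keys (x * y ^ (q - 1)) \<inter> keys (y ^ q)"
    then obtain a b where ab: "h = a + b" "a \<in> keys x" "b \<in> keys (y ^ (q - 1))"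
      using keys_mult_closed by blast
    have "D q h \<noteq> 1 \<and> rval p (D q h - 1) = m"
      using rval_unit_mult_eq[OF p m _ _ yn[OF ab(3)], of "D 1 a"] x[OF ab(2)] D[of 1 "q - 1" a b] ab(1) q
      by simp
    moreover have "D q h = 1 \<or> rval p (D q h - 1) > m" using yn h by blast
    ultimately show False by auto
  qed
  from trace_mult_star_disjoint[OF this] show ?thesis by simp
qed

text \<open>\<open>term_val p \<phi> j i\<close> is the valuation of the \<open>i\<close>-th monomial of \<open>\<phi>\<close> at a point of valuation \<open>j\<close>.\<close>

definition term_val :: "nat \<Rightarrow> rat poly \<Rightarrow> int \<Rightarrow> nat \<Rightarrow> int" where
  "term_val p \<phi> j i = rval p (coeff \<phi> i) + int i * j"

definition coeff_support :: "rat poly \<Rightarrow> nat set" where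
  "coeff_support \<phi> = {i. coeff \<phi> i \<noteq> 0}"

text \<open>Outside this set all monomials have different valuations, so a polynomial with at least
  two monomials has a unique dominant one and a unique runner-up.\<close>

definition ties :: "nat \<Rightarrow> rat poly \<Rightarrow> int set" where
  "ties p \<phi> = {j. \<exists>i\<in>coeff_support \<phi>. \<exists>k\<in>coeff_support \<phi>. i \<noteq> k \<and> term_val p \<phi> j i = term_val p \<phi> j k}"

definition lead_index :: "nat \<Rightarrow> rat poly \<Rightarrow> int \<Rightarrow> nat" where
  "lead_index p \<phi> j = arg_min_on (term_val p \<phi> j) (coeff_support \<phi>)"

definition second_index :: "nat \<Rightarrow> rat poly \<Rightarrow> int \<Rightarrow> nat" where
  "second_index p \<phi> j = arg_min_on (term_val p \<phi> j) (coeff_support \<phi> - {lead_index p \<phi> j})"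

lemma coeff_support_subset: "coeff_support \<phi> \<subseteq> {..degree \<phi>}"
  by (auto simp: coeff_support_def intro: le_degree)

lemma finite_coeff_support: "finite (coeff_support \<phi>)"
  using finite_subset[OF coeff_support_subset] by blast

text \<open>Each \<open>term_val\<close> is affine in \<open>j\<close> with slope the exponent, so a
  pair of distinct monomials ties for at most one \<open>j\<close>, which the exact division in
  \<open>?h\<close> recovers.\<close>

lemma card_ties_le: "finite (ties p \<phi>)" "card (ties p \<phi>) \<le> (degree \<phi> + 1)\<^sup>2"
proof -
  let ?h = "\<lambda>(i, k). (rval p (coeff \<phi> k) - rval p (coeff \<phi> i)) div (int i - int k)"
  have sub: "ties p \<phi> \<subseteq> ?h ` ({..degree \<phi>} \<times> {..degree \<phi>})"
  proof
    fix j assume "j \<in> ties p \<phi>"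
    then obtain i k where ik: "i \<in> coeff_support \<phi>" "k \<in> coeff_support \<phi>" "i \<noteq> k"
      and eq: "term_val p \<phi> j i = term_val p \<phi> j k"
      by (auto simp: ties_def)
    have "rval p (coeff \<phi> k) - rval p (coeff \<phi> i) = j * (int i - int k)"
      using eq by (simp add: term_val_def algebra_simps)
    then have "j = ?h (i, k)" using ik(3) by simp
    then show "j \<in> ?h ` ({..degree \<phi>} \<times> {..degree \<phi>})"
      using ik coeff_support_subset by (intro image_eqI[of _ _ "(i, k)"]) auto
  qed
  then show "finite (ties p \<phi>)" by (rule finite_subset) simp
  have "card (ties p \<phi>) \<le> card (?h ` ({..degree \<phi>} \<times> {..degree \<phi>}))"
    using sub by (intro card_mono) auto
  also have "\<dots> \<le> card ({..degree \<phi>} \<times> {..degree \<phi>})" by (rule card_image_le) simp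
  finally show "card (ties p \<phi>) \<le> (degree \<phi> + 1)\<^sup>2"
    by (simp add: card_cartesian_product power2_eq_square)
qed

lemma lead_index_second_index:
  assumes deg: "degree \<phi> \<ge> 1" and \<phi>0: "poly \<phi> 0 \<noteq> 0" and j: "j \<notin> ties p \<phi>"
  shows "lead_index p \<phi> j \<in> coeff_support \<phi>" "second_index p \<phi> j \<in> coeff_support \<phi>" "second_index p \<phi> j \<noteq> lead_index p \<phi> j"
    "term_val p \<phi> j (lead_index p \<phi> j) < term_val p \<phi> j (second_index p \<phi> j)"
    "\<And>l. l \<in> coeff_support \<phi> - {lead_index p \<phi> j, second_index p \<phi> j} \<Longrightarrow>
      term_val p \<phi> j (second_index p \<phi> j) < term_val p \<phi> j l"
proof -
  let ?t = "term_val p \<phi> j" and ?k = "lead_index p \<phi> j" and ?i = "second_index p \<phi> j"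
  \<comment> \<open>The constant and the leading monomial are both present and distinct, so a second
    index exists.\<close>
  have S: "0 \<in> coeff_support \<phi>" "degree \<phi> \<in> coeff_support \<phi>"
    using \<phi>0 deg by (auto simp: coeff_support_def poly_0_coeff_0)
  have inj: "?t l \<noteq> ?t l'" if "l \<in> coeff_support \<phi>" "l' \<in> coeff_support \<phi>" "l \<noteq> l'" for l l'
    using j that by (auto simp: ties_def)
  have "coeff_support \<phi> \<noteq> {}" using S by blast
  note k = arg_min_if_finite[OF finite_coeff_support this, of ?t, folded lead_index_def]
  have ne: "coeff_support \<phi> - {?k} \<noteq> {}" using S deg by (cases "?k = 0") auto
  have "finite (coeff_support \<phi> - {?k})" using finite_coeff_support by simp
  note i = arg_min_if_finite[OF this ne, of ?t, folded second_index_def]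
  show k1: "?k \<in> coeff_support \<phi>" and i1: "?i \<in> coeff_support \<phi>" and ik: "?i \<noteq> ?k" using k(1) i(1) by auto
  show "?t ?k < ?t ?i" using k(2) i1 inj[OF i1 k1 ik] by (metis linorder_neqE)
  show "?t ?i < ?t l" if "l \<in> coeff_support \<phi> - {?k, ?i}" for l
    using i(2) that inj[of l ?i] i1 by (metis DiffE DiffI insertCI linorder_neqE singletonD)
qed

text \<open>Every monomial besides those of index \<open>k\<close> and \<open>i\<close> has larger
  valuation than the \<open>i\<close>-th, so \<open>u - 1\<close> has the valuation of the ratio of
  the \<open>i\<close>-th to the \<open>k\<close>-th. For fixed \<open>k\<close> and
  \<open>i\<close> this is affine in \<open>rval p a\<close> with nonzero slope.\<close>

lemma poly_leading_expansion:
  assumes p: "prime p" and deg: "degree \<phi> \<ge> 1" and \<phi>0: "poly \<phi> 0 \<noteq> 0"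
    and a: "a \<noteq> 0" "rval p a \<notin> ties p \<phi>"
  defines "k \<equiv> lead_index p \<phi> (rval p a)" and "i \<equiv> second_index p \<phi> (rval p a)"
  defines "u \<equiv> poly \<phi> a / (coeff \<phi> k * a ^ k)"
  shows "u \<noteq> 1" "rval p (u - 1) = term_val p \<phi> (rval p a) i - term_val p \<phi> (rval p a) k"
proof -
  let ?j = "rval p a"
  note ls = lead_index_second_index[OF deg \<phi>0 a(2), folded k_def i_def]
  define T where "T = (\<lambda>l. coeff \<phi> l * a ^ l)"
  have Tnz: "T l \<noteq> 0" and Tv: "rval p (T l) = term_val p \<phi> ?j l" if "l \<in> coeff_support \<phi>" for l
    using that a by (auto simp: T_def coeff_support_def term_val_def rval_mult[OF p] rval_power[OF p])
  define R where "R = sum T (coeff_support \<phi> - {k, i})"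
  have "poly \<phi> a = sum T {..degree \<phi>}" by (simp add: poly_altdef T_def)
  also have "\<dots> = sum T (coeff_support \<phi>)"
    using coeff_support_subset by (intro sum.mono_neutral_right) (auto simp: coeff_support_def T_def)
  also have "\<dots> = T k + sum T (coeff_support \<phi> - {k})" using ls(1) finite_coeff_support by (simp add: sum.remove)
  also have "sum T (coeff_support \<phi> - {k}) = T i + sum T (coeff_support \<phi> - {k} - {i})"
    using ls(2,3) finite_coeff_support by (intro sum.remove) auto
  also have "coeff_support \<phi> - {k} - {i} = coeff_support \<phi> - {k, i}" by auto
  finally have \<phi>a: "poly \<phi> a = T k + (T i + R)" by (simp add: R_def)
  have "R = 0 \<or> rval p (T i) < rval p R"
  proof (cases "R = 0")
    case False
    have "term_val p \<phi> ?j i + 1 \<le> rval p R"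
      unfolding R_def
    proof (rule rval_sum_ge[OF p])
      show "finite (coeff_support \<phi> - {k, i})" using finite_coeff_support by simp
      show "term_val p \<phi> ?j i + 1 \<le> rval p (T l)" if "l \<in> coeff_support \<phi> - {k, i}" for l
        using ls(5)[OF that] Tv[of l] that by simp
      show "sum T (coeff_support \<phi> - {k, i}) \<noteq> 0" using False by (simp add: R_def)
    qed
    then show ?thesis using Tv[OF ls(2)] by simp
  qed simp
  note y = rval_add_eq[OF p Tnz[OF ls(2)] this]
  have u: "u - 1 = (T i + R) / T k"
  proof -
    have "u = poly \<phi> a / T k" by (simp add: u_def T_def)
    then show ?thesis using Tnz[OF ls(1)] by (simp add: \<phi>a field_simps)
  qed
  show "u \<noteq> 1" using u y(1) Tnz[OF ls(1)] by auto
  show "rval p (u - 1) = term_val p \<phi> ?j i - term_val p \<phi> ?j k"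
    unfolding u using y Tnz[OF ls(1)] Tv[OF ls(1)] Tv[OF ls(2)] by (simp add: rval_divide[OF p])
qed

section \<open>Energy of weighted polynomial graphs\<close>

definition graph_point :: "rat poly \<Rightarrow> nzrat \<Rightarrow> nzrat \<times> nzrat" where
  "graph_point \<phi> a = (a, nz (poly \<phi> (rat_of a)))"

text \<open>A measure on the graph over \<open>S\<close>. The use of \<open>nz\<close> is meaningful
  only away from the zeros of \<open>\<phi>\<close>, hence the nonvanishing hypotheses
  later.\<close>

definition graph_alg :: "rat poly \<Rightarrow> (nzrat \<Rightarrow> real) \<Rightarrow> nzrat set \<Rightarrow> nzrat \<times> nzrat \<Rightarrow>\<^sub>0 real" where
  "graph_alg \<phi> w S = (\<Sum>a\<in>S. Poly_Mapping.single (graph_point \<phi> a) (w a))"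

lemma nonneg_graph_alg: "(\<And>a. a \<in> S \<Longrightarrow> w a \<ge> 0) \<Longrightarrow> nonneg (graph_alg \<phi> w S)"
  unfolding graph_alg_def by (intro nonneg_sum) simp

lemma keys_graph_alg: "keys (graph_alg \<phi> w S) \<subseteq> graph_point \<phi> ` S"
proof -
  have "keys (graph_alg \<phi> w S) \<subseteq> (\<Union>a\<in>S. keys (Poly_Mapping.single (graph_point \<phi> a) (w a)))"
    unfolding graph_alg_def by (rule Poly_Mapping.keys_sum)
  then show ?thesis by (auto split: if_splits)
qed

text \<open>For fixed dominant indices the level \<open>m j\<close> of the graph points of valuation
  \<open>j\<close> is injective in \<open>j\<close>. A relation between \<open>q\<close>-fold
  products in which just one point has the least level is impossible, which is the orthogonality
  required of the fibres.\<close>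

lemma energy_graph_class_le:
  fixes w :: "nzrat \<Rightarrow> real" and S :: "nzrat set" and s :: "int \<Rightarrow> real"
  assumes q: "q \<ge> 2" and p: "prime p" and deg: "degree \<phi> \<ge> 1" and \<phi>0: "poly \<phi> 0 \<noteq> 0"
    and fin: "finite J" and w: "\<And>a. a \<in> S \<Longrightarrow> w a \<ge> 0"
    and nz\<phi>: "\<And>a. a \<in> S \<Longrightarrow> poly \<phi> (rat_of a) \<noteq> 0"
    and J: "\<And>j. j \<in> J \<Longrightarrow> j \<notin> ties p \<phi> \<and> lead_index p \<phi> j = k \<and> second_index p \<phi> j = i"
    and s: "\<And>j. j \<in> J \<Longrightarrow> s j \<ge> 0"
    and e: "\<And>j. j \<in> J \<Longrightarrow> energy q (graph_alg \<phi> w {a \<in> S. rval p (rat_of a) = j}) \<le> s j ^ q"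
  shows "energy q (\<Sum>j\<in>J. graph_alg \<phi> w {a \<in> S. rval p (rat_of a) = j}) \<le>
    (3 * real (q\<^sup>2) * (\<Sum>j\<in>J. s j)) ^ q"
proof (cases "J = {}")
  case True
  then show ?thesis using q by (simp add: energy_def zero_power)
next
  case False
  let ?f = "\<lambda>j. graph_alg \<phi> w {a \<in> S. rval p (rat_of a) = j}"
  define m where "m = (\<lambda>j. term_val p \<phi> j i - term_val p \<phi> j k)"
  have ik: "i \<noteq> k" "k \<in> coeff_support \<phi>" and mpos: "\<And>j. j \<in> J \<Longrightarrow> m j > 0"
    using False J lead_index_second_index[OF deg \<phi>0] by (fastforce simp: m_def)+
  have inj: "inj_on m J"
  proof (rule inj_onI)
    fix j j' assume "m j = m j'"
    then have "(int i - int k) * (j - j') = 0"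
      by (simp add: m_def term_val_def algebra_simps)
    then show "j = j'" using ik by simp
  qed
  define D where "D = (\<lambda>n h. rat_of (snd h) / (coeff \<phi> k ^ n * rat_of (fst h) ^ k))"
  have key: "D 1 h \<noteq> 1 \<and> rval p (D 1 h - 1) = m j" if h: "h \<in> keys (?f j)" and j: "j \<in> J" for h j
  proof -
    obtain a where a: "a \<in> S" "rval p (rat_of a) = j" "h = graph_point \<phi> a"
      using h keys_graph_alg by blast
    have "D 1 h = poly \<phi> (rat_of a) / (coeff \<phi> k * rat_of a ^ k)"
      using nz\<phi>[OF a(1)] by (simp add: D_def a(3) graph_point_def)
    then show ?thesis
      using poly_leading_expansion[OF p deg \<phi>0, of "rat_of a"] J[OF j] a(2) by (simp add: m_def)
  qed
  have "energy q (sum ?f J) \<le> 3 * real (q\<^sup>2) * (\<Sum>j\<in>J. mixed_energy q (?f j) (sum ?f J))"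
  proof (rule energy_sum_orthogonal_le[OF q fin inj])
    show "nonneg (?f j)" for j using w by (intro nonneg_graph_alg) auto
    fix j J' assume j: "j \<in> J" and J': "J' \<subseteq> {i \<in> J. m i > m j}"
    show "trace (?f j * sum ?f J' ^ (q - 1) * star (sum ?f J') ^ q) = 0"
    proof (rule trace_eq_zero_of_rval[OF p, where c = "coeff \<phi> k" and m = "m j" and k = k])
      show "coeff \<phi> k \<noteq> 0" using ik(2) by (simp add: coeff_support_def)
      show "m j > 0" using mpos[OF j] .
      show "1 \<le> q" using q by simp
      show "rat_of (snd h) / (coeff \<phi> k ^ 1 * rat_of (fst h) ^ k) \<noteq> 1 \<and>
          rval p (rat_of (snd h) / (coeff \<phi> k ^ 1 * rat_of (fst h) ^ k) - 1) = m j"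
        if "h \<in> keys (?f j)" for h
        using key[OF that j] by (simp add: D_def)
      show "rat_of (snd h) / (coeff \<phi> k ^ 1 * rat_of (fst h) ^ k) = 1 \<or>
          m j < rval p (rat_of (snd h) / (coeff \<phi> k ^ 1 * rat_of (fst h) ^ k) - 1)"
        if h: "h \<in> keys (sum ?f J')" for h
      proof -
        obtain j' where j': "j' \<in> J'" "h \<in> keys (?f j')" using h Poly_Mapping.keys_sum[of ?f J'] by blast
        then have "j' \<in> J" "m j < m j'" using J' by auto
        then show ?thesis using key[OF j'(2)] by (simp add: D_def)
      qed
    qed
  qed
  then show ?thesis using q by (intro root_energy_le[where f = ?f] fin s e) auto
qed

text \<open>The valuations are classified: each tie alone, the others by their pair of dominant
  indices. Orthogonality inside a class costs \<open>3 * real (q\<^sup>2)\<close>, and joining at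
  most \<open>2 * (degree \<phi> + 1)\<^sup>2\<close> classes by Cauchy--Schwarz costs their
  number.\<close>

lemma energy_graph_fibres_le:
  fixes w :: "nzrat \<Rightarrow> real" and S :: "nzrat set" and s :: "int \<Rightarrow> real"
  assumes q: "q \<ge> 2" and p: "prime p" and deg: "degree \<phi> \<ge> 1" and \<phi>0: "poly \<phi> 0 \<noteq> 0"
    and fin: "finite S" and w: "\<And>a. a \<in> S \<Longrightarrow> w a \<ge> 0"
    and nz\<phi>: "\<And>a. a \<in> S \<Longrightarrow> poly \<phi> (rat_of a) \<noteq> 0"
  defines "v \<equiv> \<lambda>a. rval p (rat_of a)"
  assumes s: "\<And>j. j \<in> v ` S \<Longrightarrow> s j \<ge> 0"
    and e: "\<And>j. j \<in> v ` S \<Longrightarrow> energy q (graph_alg \<phi> w {a \<in> S. v a = j}) \<le> s j ^ q"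
  shows "energy q (graph_alg \<phi> w S) \<le>
    (6 * real ((degree \<phi> + 1)\<^sup>2) * real (q\<^sup>2) * (\<Sum>j\<in>v ` S. s j)) ^ q"
proof -
  let ?f = "\<lambda>j. graph_alg \<phi> w {a \<in> S. v a = j}"
  define lab where "lab = (\<lambda>j. if j \<in> ties p \<phi> then Inl j else Inr (lead_index p \<phi> j, second_index p \<phi> j))"
  let ?J = "\<lambda>l. {j \<in> v ` S. lab j = l}"
  let ?L = "lab ` v ` S"
  define F where "F = (\<lambda>l. sum ?f (?J l))"
  define t where "t = (\<lambda>l. 3 * real (q\<^sup>2) * (\<Sum>j\<in>?J l. s j))"
  have finL: "finite ?L" using fin by simp
  have t: "t l \<ge> 0" for l using s by (auto simp: t_def intro!: mult_nonneg_nonneg sum_nonneg)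
  have nnF: "nonneg (F l)" for l
    unfolding F_def using w by (intro nonneg_sum nonneg_graph_alg) auto
  have sumF: "graph_alg \<phi> w S = sum F ?L"
  proof -
    have "graph_alg \<phi> w S = (\<Sum>j\<in>v ` S. ?f j)"
      unfolding graph_alg_def using fin by (intro sum.group[symmetric]) auto
    also have "\<dots> = sum F ?L"
      unfolding F_def using fin by (intro sum.group[symmetric]) auto
    finally show ?thesis .
  qed
  have eF: "energy q (F l) \<le> t l ^ q" if "l \<in> ?L" for l
  proof (cases l)
    case (Inl j)
    then have "?J l = {j}" using that by (auto simp: lab_def split: if_splits)
    then have F: "F l = ?f j" and tl: "t l = 3 * real (q\<^sup>2) * s j" and j: "j \<in> v ` S"
      by (auto simp: F_def t_def)
    have "1 * s j \<le> 3 * real (q\<^sup>2) * s j"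
    proof (rule mult_right_mono)
      have "1 \<le> q\<^sup>2" using q by simp
      then show "1 \<le> 3 * real (q\<^sup>2)" by linarith
    qed (rule s[OF j])
    then have "s j ^ q \<le> t l ^ q" using s[OF j] by (intro power_mono) (auto simp: tl)
    then show ?thesis using e[OF j] F by simp
  next
    case (Inr ki)
    obtain k i where ki: "ki = (k, i)" by force
    show ?thesis
      unfolding F_def t_def v_def
    proof (rule energy_graph_class_le[OF q p deg \<phi>0 _ w nz\<phi>])
      show "finite {j \<in> (\<lambda>a. rval p (rat_of a)) ` S. lab j = l}" using fin by simp
      show "j \<notin> ties p \<phi> \<and> lead_index p \<phi> j = k \<and> second_index p \<phi> j = i"
        if "j \<in> {j \<in> (\<lambda>a. rval p (rat_of a)) ` S. lab j = l}" for j
        using that Inr ki by (auto simp: lab_def split: if_splits)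
    qed (use s e in \<open>auto simp: v_def\<close>)
  qed
  let ?N = "2 * real ((degree \<phi> + 1)\<^sup>2)"
  have cardL: "real (card ?L) \<le> ?N"
  proof -
    have "?L \<subseteq> Inl ` ties p \<phi> \<union> Inr ` ({..degree \<phi>} \<times> {..degree \<phi>})"
      using lead_index_second_index[OF deg \<phi>0] coeff_support_subset by (fastforce simp: lab_def)
    then have "card ?L \<le> card (Inl ` ties p \<phi> \<union> Inr ` ({..degree \<phi>} \<times> {..degree \<phi>}) :: (int + nat \<times> nat) set)"
      using card_ties_le by (intro card_mono) auto
    also have "\<dots> \<le> card (Inl ` ties p \<phi> :: (int + nat \<times> nat) set) +
        card (Inr ` ({..degree \<phi>} \<times> {..degree \<phi>}) :: (int + nat \<times> nat) set)"
      by (rule card_Un_le)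
    also have "\<dots> \<le> (degree \<phi> + 1)\<^sup>2 + (degree \<phi> + 1)\<^sup>2"
      using card_ties_le[of p \<phi>] by (simp add: card_image card_cartesian_product power2_eq_square)
    finally show ?thesis by linarith
  qed
  have "energy q (sum F ?L) \<le> real (card ?L) * (\<Sum>l\<in>?L. mixed_energy q (F l) (sum F ?L))"
    using q nnF by (intro energy_sum_le finL) auto
  also have "\<dots> \<le> ?N * (\<Sum>l\<in>?L. mixed_energy q (F l) (sum F ?L))"
    using cardL by (intro mult_right_mono sum_nonneg mixed_energy_nonneg)
  finally have "energy q (sum F ?L) \<le> (?N * (\<Sum>l\<in>?L. t l)) ^ q"
    using q t eF finL by (intro root_energy_le) auto
  also have "(\<Sum>l\<in>?L. t l) = 3 * real (q\<^sup>2) * (\<Sum>j\<in>v ` S. s j)"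
  proof -
    have "(\<Sum>l\<in>?L. \<Sum>j\<in>?J l. s j) = (\<Sum>j\<in>v ` S. s j)"
      using fin by (intro sum.group) auto
    then show ?thesis by (simp add: t_def sum_distrib_left[symmetric])
  qed
  finally show ?thesis by (simp add: sumF mult.assoc mult.left_commute)
qed

subsection \<open>Weights that control the energy of every polynomial graph\<close>

text \<open>For \<open>w = 1\<close> the right side counts the diagonal solutions of the equation
  between \<open>q\<close>-fold products. The bound is demanded for every polynomial of degree
  \<open>d\<close> that is nonzero at \<open>0\<close>, so that dilating the variable preserves it,
  and for every subset, so that restriction does.\<close>

definition admissible :: "nat \<Rightarrow> nat \<Rightarrow> nzrat set \<Rightarrow> (nzrat \<Rightarrow> real) \<Rightarrow> bool" where
  "admissible q d A w \<longleftrightarrow> (\<forall>a. 0 \<le> w a \<and> w a \<le> 1) \<and>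
    (\<forall>\<phi> S. degree \<phi> = d \<longrightarrow> poly \<phi> 0 \<noteq> 0 \<longrightarrow> S \<subseteq> A \<longrightarrow> (\<forall>a\<in>S. poly \<phi> (rat_of a) \<noteq> 0) \<longrightarrow>
      energy q (graph_alg \<phi> w S) \<le> (sum w S) ^ q)"

definition capacity :: "nat \<Rightarrow> nat \<Rightarrow> nzrat set \<Rightarrow> real" where
  "capacity q d A = Sup {sum w A | w. admissible q d A w}"

lemma admissibleD:
  assumes "admissible q d A w"
  shows "0 \<le> w a" "w a \<le> 1"
    "degree \<phi> = d \<Longrightarrow> poly \<phi> 0 \<noteq> 0 \<Longrightarrow> S \<subseteq> A \<Longrightarrow> (\<And>a. a \<in> S \<Longrightarrow> poly \<phi> (rat_of a) \<noteq> 0) \<Longrightarrow>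
      energy q (graph_alg \<phi> w S) \<le> (sum w S) ^ q"
  using assms by (auto simp: admissible_def)

lemma energy_zero: "q \<ge> 1 \<Longrightarrow> energy q 0 = 0"
  by (simp add: energy_def zero_power)

lemma admissible_zero: "q \<ge> 1 \<Longrightarrow> admissible q d A (\<lambda>_. 0)"
  by (simp add: admissible_def graph_alg_def energy_zero zero_power)

lemma sum_le_capacity:
  assumes "finite A" "admissible q d A w"
  shows "sum w A \<le> capacity q d A"
  unfolding capacity_def
proof (rule cSup_upper)
  show "sum w A \<in> {sum w A | w. admissible q d A w}" using assms by blast
  have "sum w' A \<le> real (card A)" if "admissible q d A w'" for w'
    using sum_bounded_above[of A w' 1] admissibleD(2)[OF that] by simp
  then show "bdd_above {sum w A | w. admissible q d A w}"
    by (intro bdd_aboveI[of _ "real (card A)"]) auto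
qed

lemma capacity_approx:
  assumes "q \<ge> 1" "e > 0"
  obtains w where "admissible q d A w" "capacity q d A - e < sum w A"
proof -
  have "{sum w A | w. admissible q d A w} \<noteq> {}" using admissible_zero[OF assms(1)] by blast
  then obtain y where "y \<in> {sum w A | w. admissible q d A w}" "capacity q d A - e < y"
    unfolding capacity_def using less_cSupD[of "{sum w A | w. admissible q d A w}"] assms(2)
    by (metis (no_types, lifting) diff_less_eq less_add_same_cancel1)
  then show ?thesis using that by blast
qed

lemma capacity_mono:
  assumes q: "q \<ge> 1" and fin: "finite B" and sub: "A \<subseteq> B"
  shows "capacity q d A \<le> capacity q d B"
  unfolding capacity_def[of q d A]
proof (rule cSup_least)
  show "{sum w A | w. admissible q d A w} \<noteq> {}" using admissible_zero[OF q] by blast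
  fix y assume "y \<in> {sum w A | w. admissible q d A w}"
  then obtain w where w: "admissible q d A w" and y: "y = sum w A" by blast
  \<comment> \<open>Extension by zero: both sides of the admissibility bound then see only
    \<open>S \<inter> A\<close>.\<close>
  define w' where "w' = (\<lambda>a. if a \<in> A then w a else 0)"
  have sum: "sum w' S = sum w (S \<inter> A)" if "finite S" for S
    unfolding w'_def using that by (simp add: sum.If_cases)
  have alg: "graph_alg \<phi> w' S = graph_alg \<phi> w (S \<inter> A)" if "finite S" for S \<phi>
    unfolding graph_alg_def w'_def using that
    by (intro sum.mono_neutral_cong_right) auto
  have "admissible q d B w'"
    unfolding admissible_def
  proof (intro conjI allI impI)
    show "0 \<le> w' a" "w' a \<le> 1" for a using admissibleD(1,2)[OF w] by (auto simp: w'_def)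
    fix \<phi> S assume "degree \<phi> = d" "poly \<phi> 0 \<noteq> 0" "S \<subseteq> B" "\<forall>a\<in>S. poly \<phi> (rat_of a) \<noteq> 0"
    then show "energy q (graph_alg \<phi> w' S) \<le> (sum w' S) ^ q"
      using admissibleD(3)[OF w, of \<phi> "S \<inter> A"] finite_subset[OF _ fin, of S] by (simp add: alg sum)
  qed
  then have "sum w' B \<le> capacity q d B" by (rule sum_le_capacity[OF fin])
  moreover have "sum w' B = y" using sum[OF fin] sub y by (simp add: Int_absorb1)
  ultimately show "y \<le> capacity q d B" by simp
qed

lemma star_single: "star (Poly_Mapping.single h c) = Poly_Mapping.single (- h) c"
  by (rule poly_mapping_eqI) (auto simp: lookup_single when_def)

lemma energy_single: "energy q (Poly_Mapping.single h 1) = 1"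
proof -
  have "Poly_Mapping.single h 1 * star (Poly_Mapping.single h (1 :: real)) = 1"
    by (simp add: star_single mult_single)
  then show ?thesis by (simp add: energy_def power_mult_distrib[symmetric])
qed

lemma energy_scale: "energy q (Poly_Mapping.single 0 t * f) = t ^ (2 * q) * energy q f"
proof -
  have pow: "Poly_Mapping.single 0 t ^ n = Poly_Mapping.single (0 :: 'a) (t ^ n)" for n
    by (induction n) (auto simp: mult_single)
  have "(Poly_Mapping.single 0 t * f) ^ q * star (Poly_Mapping.single 0 t * f) ^ q =
      Poly_Mapping.single 0 (t ^ q * t ^ q) * (f ^ q * star f ^ q)"
  proof -
    have "Poly_Mapping.single (0 :: 'a) (t ^ q * t ^ q) =
        Poly_Mapping.single 0 (t ^ q) * Poly_Mapping.single 0 (t ^ q)"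
      by (simp add: mult_single)
    then show ?thesis by (simp add: star_single power_mult_distrib pow ac_simps)
  qed
  then show ?thesis
    by (simp add: energy_def lookup_single_mult power_add[symmetric] mult_2)
qed

lemma capacity_ge_one:
  assumes q: "q \<ge> 1" and A: "finite A" "A \<noteq> {}"
  shows "capacity q d A \<ge> 1"
proof -
  obtain a where a: "a \<in> A" using A by blast
  have "admissible q d {a} (\<lambda>_. 1)"
    unfolding admissible_def
  proof (intro conjI allI impI)
    fix \<phi> and S :: "nzrat set" assume "S \<subseteq> {a}"
    then consider "S = {}" | "S = {a}" by blast
    then show "energy q (graph_alg \<phi> (\<lambda>_. 1) S) \<le> (\<Sum>_\<in>S. 1) ^ q"
      using q by cases (simp_all add: graph_alg_def energy_zero energy_single)
  qed simp_all
  then have "1 \<le> capacity q d {a}" using sum_le_capacity[of "{a}"] by fastforce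
  also have "\<dots> \<le> capacity q d A" using A a by (intro capacity_mono q) auto
  finally show ?thesis .
qed

text \<open>Near-optimal weights on the fibres are glued and multiplied by \<open>\<theta>\<close>.
  The energy is homogeneous of degree \<open>2 * q\<close> but the admissible bound only of degree
  \<open>q\<close>, so the constant \<open>1 / \<theta>\<close> of the fibre estimate is
  absorbed.\<close>

lemma capacity_split:
  assumes q: "q \<ge> 2" and d: "d \<ge> 1" and p: "prime p" and fin: "finite A"
  defines "v \<equiv> \<lambda>a. rval p (rat_of a)" and "\<theta> \<equiv> 1 / (6 * real ((d + 1)\<^sup>2) * real (q\<^sup>2))"
  shows "\<theta> * (\<Sum>j\<in>v ` A. capacity q d {a \<in> A. v a = j}) \<le> capacity q d A"
proof (rule field_le_epsilon)
  fix e :: real assume e: "e > 0"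
  \<comment> \<open>Attainment of the supremum is not assumed, so the error \<open>e\<close> is
    shared among the fibres; the added \<open>1\<close> keeps \<open>?n\<close> positive when there
    are none.\<close>
  let ?A = "\<lambda>j. {a \<in> A. v a = j}" and ?n = "real (card (v ` A)) + 1"
  define C where "C = 6 * real ((d + 1)\<^sup>2) * real (q\<^sup>2)"
  have "1 \<le> (d + 1)\<^sup>2" "1 \<le> q\<^sup>2" using q by simp_all
  then have "1 * 1 \<le> real ((d + 1)\<^sup>2) * real (q\<^sup>2)" by (intro mult_mono) linarith+
  then have C: "C \<ge> 1" by (simp add: C_def)
  have \<theta>C: "\<theta> = 1 / C" by (simp add: \<theta>_def C_def)
  have \<theta>: "0 < \<theta>" "\<theta> \<le> 1" using C by (simp_all add: \<theta>C)
  have "\<exists>w. admissible q d (?A j) w \<and> capacity q d (?A j) - e / ?n < sum w (?A j)" for j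
  proof -
    have "1 \<le> q" "0 < e / ?n" using q e by (auto intro!: divide_pos_pos add_nonneg_pos)
    from capacity_approx[OF this] show ?thesis by blast
  qed
  then have "\<exists>w. \<forall>j. admissible q d (?A j) (w j) \<and> capacity q d (?A j) - e / ?n < sum (w j) (?A j)"
    by (intro choice allI)
  then obtain w where w: "\<And>j. admissible q d (?A j) (w j)"
    "\<And>j. capacity q d (?A j) - e / ?n < sum (w j) (?A j)" by blast
  define u where "u = (\<lambda>a. w (v a) a)"
  define W where "W = (\<lambda>a. \<theta> * u a)"
  have u: "0 \<le> u a" "u a \<le> 1" for a using admissibleD(1,2)[OF w(1)] by (auto simp: u_def)
  have "admissible q d A W"
    unfolding admissible_def
  proof (intro conjI allI impI)
    show "0 \<le> W a" for a using u \<theta> by (simp add: W_def)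
    show "W a \<le> 1" for a using u[of a] \<theta> mult_mono[of \<theta> 1 "u a" 1] by (simp add: W_def)
    fix \<phi> S assume \<phi>: "degree \<phi> = d" "poly \<phi> 0 \<noteq> 0" and S: "S \<subseteq> A" "\<forall>a\<in>S. poly \<phi> (rat_of a) \<noteq> 0"
    have finS: "finite S" using S fin finite_subset by blast
    let ?S = "\<lambda>j. {a \<in> S. v a = j}"
    have "energy q (graph_alg \<phi> u S) \<le>
        (6 * real ((degree \<phi> + 1)\<^sup>2) * real (q\<^sup>2) * (\<Sum>j\<in>v ` S. sum u (?S j))) ^ q"
      unfolding v_def
    proof (rule energy_graph_fibres_le[OF q p _ \<phi>(2) finS])
      show "1 \<le> degree \<phi>" using \<phi> d by simp
      show "poly \<phi> (rat_of a) \<noteq> 0" if "a \<in> S" for a using S that by blast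
      show "0 \<le> sum u {a \<in> S. rval p (rat_of a) = j}" for j using u by (intro sum_nonneg) auto
      show "energy q (graph_alg \<phi> u {a \<in> S. rval p (rat_of a) = j}) \<le>
          sum u {a \<in> S. rval p (rat_of a) = j} ^ q" for j
      proof -
        have "graph_alg \<phi> u (?S j) = graph_alg \<phi> (w j) (?S j)" "sum u (?S j) = sum (w j) (?S j)"
          unfolding graph_alg_def by (auto simp: u_def intro!: sum.cong)
        moreover have "energy q (graph_alg \<phi> (w j) (?S j)) \<le> sum (w j) (?S j) ^ q"
          using S by (intro admissibleD(3)[OF w(1)] \<phi>) auto
        ultimately show ?thesis by (simp add: v_def)
      qed
    qed (rule u)
    moreover have "(\<Sum>j\<in>v ` S. sum u (?S j)) = sum u S"
      using finS by (intro sum.group) auto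
    ultimately have eu: "energy q (graph_alg \<phi> u S) \<le> (C * sum u S) ^ q"
      by (simp add: C_def \<phi>)
    have "graph_alg \<phi> W S = Poly_Mapping.single 0 \<theta> * graph_alg \<phi> u S"
      by (simp add: graph_alg_def W_def sum_distrib_left mult_single)
    then have "energy q (graph_alg \<phi> W S) = \<theta> ^ (2 * q) * energy q (graph_alg \<phi> u S)"
      by (simp add: energy_scale)
    also have "\<dots> \<le> \<theta> ^ (2 * q) * (C * sum u S) ^ q" using eu \<theta> by (intro mult_left_mono) auto
    also have "\<dots> = (\<theta>\<^sup>2 * (C * sum u S)) ^ q" by (simp only: power_mult power_mult_distrib)
    also have "\<theta>\<^sup>2 * (C * sum u S) = sum W S"
      using C by (simp add: W_def sum_divide_distrib \<theta>C power2_eq_square)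
    finally show "energy q (graph_alg \<phi> W S) \<le> (sum W S) ^ q" .
  qed
  then have le: "sum W A \<le> capacity q d A" by (rule sum_le_capacity[OF fin])
  have "(\<Sum>j\<in>v ` A. capacity q d (?A j)) \<le> (\<Sum>j\<in>v ` A. sum (w j) (?A j) + e / ?n)"
    using w(2) by (intro sum_mono) (simp add: algebra_simps less_imp_le)
  also have "\<dots> = (\<Sum>j\<in>v ` A. sum u (?A j)) + real (card (v ` A)) * (e / ?n)"
    by (simp add: sum.distrib u_def)
  also have "(\<Sum>j\<in>v ` A. sum u (?A j)) = sum u A" using fin by (intro sum.group) auto
  also have "real (card (v ` A)) * (e / ?n) \<le> e" using e by (simp add: field_simps)
  finally have "\<theta> * (\<Sum>j\<in>v ` A. capacity q d (?A j)) \<le> \<theta> * (sum u A + e)"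
    using \<theta> by (intro mult_left_mono) auto
  also have "\<dots> = sum W A + \<theta> * e" by (simp add: W_def sum_distrib_left algebra_simps)
  also have "\<dots> \<le> capacity q d A + e" using le \<theta> e by (intro add_mono) (auto simp: mult_left_le_one_le)
  finally show "\<theta> * (\<Sum>j\<in>v ` A. capacity q d (?A j)) \<le> capacity q d A + e" .
qed

section \<open>Total mass and supports of powers\<close>

definition mass :: "('g::ab_group_add \<Rightarrow>\<^sub>0 real) \<Rightarrow> real" where
  "mass f = (\<Sum>k\<in>keys f. lookup f k)"

lemma mass_superset: "finite S \<Longrightarrow> keys f \<subseteq> S \<Longrightarrow> mass f = (\<Sum>k\<in>S. lookup f k)"
  unfolding mass_def by (rule sum.mono_neutral_left) (auto simp: in_keys_iff)

lemma mass_add: "mass (f + g) = mass f + mass g"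
  unfolding mass_def by (rule setsum_keys_plus_distrib) auto

lemma mass_sum: "mass (sum f I) = (\<Sum>i\<in>I. mass (f i))"
  by (induction I rule: infinite_finite_induct) (auto simp: mass_add, auto simp: mass_def)

lemma mass_single [simp]: "mass (Poly_Mapping.single a c) = c"
  by (subst mass_superset[of "{a}"]) auto

lemma mass_single_mult: "mass (Poly_Mapping.single a c * f) = c * mass f"
proof -
  have "keys (Poly_Mapping.single a c * f) \<subseteq> (\<lambda>k. k + a) ` keys f"
  proof
    fix k assume "k \<in> keys (Poly_Mapping.single a c * f)"
    then have "k - a \<in> keys f" by (auto simp: in_keys_iff lookup_single_mult)
    then show "k \<in> (\<lambda>k. k + a) ` keys f" by (intro image_eqI[of _ _ "k - a"]) auto
  qed
  then have "mass (Poly_Mapping.single a c * f) = (\<Sum>k\<in>(\<lambda>k. k + a) ` keys f. c * lookup f (k - a))"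
    by (subst mass_superset[of "(\<lambda>k. k + a) ` keys f"]) (auto simp: lookup_single_mult)
  also have "\<dots> = (\<Sum>k\<in>keys f. c * lookup f k)"
    by (subst sum.reindex) (auto simp: inj_on_def)
  finally show ?thesis by (simp add: mass_def sum_distrib_left)
qed

lemma mass_mult: "mass (f * g) = mass f * mass g"
proof -
  have "f * g = (\<Sum>a\<in>keys f. Poly_Mapping.single a (lookup f a) * g)"
    by (simp add: sum_distrib_right[symmetric] sum_single_keys)
  then have "mass (f * g) = (\<Sum>a\<in>keys f. lookup f a * mass g)"
    by (simp only: mass_sum mass_single_mult)
  then show ?thesis by (simp add: mass_def sum_distrib_right)
qed

lemma mass_power: "mass (f ^ n) = mass f ^ n"
proof (induction n)
  case 0
  show ?case by (simp add: mass_def)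
qed (simp add: mass_mult)

text \<open>Cauchy--Schwarz over the support of \<open>f ^ q\<close>: mass concentrated on few
  products forces a large energy.\<close>

lemma mass_le_energy:
  assumes "finite T" "keys (f ^ q) \<subseteq> T"
  shows "mass f ^ (2 * q) \<le> real (card T) * energy q f"
proof -
  have "mass f ^ (2 * q) = (\<Sum>k\<in>keys (f ^ q). 1 * lookup (f ^ q) k)\<^sup>2"
    using mass_power[of f q] by (simp add: mass_def power_mult[symmetric] mult.commute)
  also have "\<dots> \<le> (\<Sum>k\<in>keys (f ^ q). 1\<^sup>2) * (\<Sum>k\<in>keys (f ^ q). (lookup (f ^ q) k)\<^sup>2)"
    by (rule Cauchy_Schwarz_ineq_sum)
  also have "\<dots> = real (card (keys (f ^ q))) * energy q f" by (simp add: energy_eq_sum)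
  also have "\<dots> \<le> real (card T) * energy q f"
    using card_mono[OF assms] energy_nonneg by (intro mult_right_mono) auto
  finally show ?thesis .
qed

lemma mass_graph_alg: "mass (graph_alg \<phi> w S) = sum w S"
  by (simp add: graph_alg_def mass_sum)

text \<open>Each factor of a product shifts the first coordinate by \<open>x\<close>, so
  \<open>z\<close> accumulates to \<open>n\<close> copies of \<open>x\<close>; the second coordinate
  needs no shift.\<close>

lemma keys_power_fold_sumset:
  fixes f :: "'g::ab_group_add \<times> 'g \<Rightarrow>\<^sub>0 real"
  assumes "\<And>h. h \<in> keys f \<Longrightarrow> fst h + x \<in> A \<and> snd h \<in> A"
  shows "\<exists>z. keys (f ^ n) \<subseteq> (\<lambda>s. s - z) ` fold_sumset n A \<times> fold_sumset n A"
proof (induction n)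
  case 0
  show ?case by (intro exI[of _ 0]) (auto simp: zero_prod_def)
next
  case (Suc n)
  then obtain z where z: "keys (f ^ n) \<subseteq> (\<lambda>s. s - z) ` fold_sumset n A \<times> fold_sumset n A" by blast
  have "keys (f ^ Suc n) \<subseteq> (\<lambda>s. s - (x + z)) ` fold_sumset (Suc n) A \<times> fold_sumset (Suc n) A"
  proof
    fix h assume "h \<in> keys (f ^ Suc n)"
    then have "h \<in> keys (f * f ^ n)" by simp
    then obtain a b where ab: "h = a + b" "a \<in> keys f" "b \<in> keys (f ^ n)" by (rule keys_mult_closed)
    obtain s where s: "fst b = s - z" "s \<in> fold_sumset n A" and b2: "snd b \<in> fold_sumset n A"
      using subsetD[OF z ab(3)] by (auto simp: mem_Times_iff)
    have "fst h = ((fst a + x) + s) - (x + z)" using ab(1) s(1) by (simp add: algebra_simps)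
    moreover have "(fst a + x) + s \<in> fold_sumset (Suc n) A" "snd h \<in> fold_sumset (Suc n) A"
      using assms[OF ab(2)] s(2) b2 ab(1) by auto
    ultimately show "h \<in> (\<lambda>s. s - (x + z)) ` fold_sumset (Suc n) A \<times> fold_sumset (Suc n) A"
      unfolding mem_Times_iff by blast
  qed
  then show ?case by blast
qed

lemma root_le_powr:
  fixes W K n :: real
  assumes q: "q \<ge> 1" and W: "W \<ge> 0" and K: "K \<ge> 0" and n: "n > 0"
    and le: "W ^ (2 * q) \<le> (K ^ q * n)\<^sup>2 * W ^ q"
  shows "W \<le> K\<^sup>2 * n powr (2 / real q)"
proof (cases "W = 0")
  case False
  then have "W ^ q > 0" using W by simp
  moreover have "W ^ q * W ^ q \<le> (K ^ q * n)\<^sup>2 * W ^ q" using le by (simp add: mult_2 power_add)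
  ultimately have "W ^ q \<le> (K ^ q * n)\<^sup>2" by (simp only: mult_le_cancel_right_pos)
  also have "\<dots> = (K\<^sup>2 * n powr (2 / real q)) ^ q"
  proof -
    have "(n powr (2 / real q)) ^ q = (n powr (2 / real q)) powr real q"
      using n by (intro powr_realpow[symmetric]) simp
    also have "\<dots> = n\<^sup>2" using q n by (simp add: powr_powr)
    finally have "(n powr (2 / real q)) ^ q = n\<^sup>2" .
    moreover have "(K ^ q)\<^sup>2 = (K\<^sup>2) ^ q" by (simp only: power_mult[symmetric] mult.commute)
    ultimately show ?thesis by (simp only: power_mult_distrib)
  qed
  finally show ?thesis using q W by (subst (asm) power_mono_iff) auto
qed (use K in simp)

section \<open>Capacity and multiplicative doubling\<close>

lemma positive_part:
  fixes A :: "nzrat set"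
  assumes fin: "finite A" and ne: "A \<noteq> {}"
  obtains B g where "finite B" "B \<noteq> {}" "B \<subseteq> {a. rat_of a > 0}" "card A \<le> 2 * card B"
    "(\<lambda>b. b + g) ` B \<subseteq> A" "B + B \<subseteq> A + A"
proof -
  define P where "P = {a \<in> A. rat_of a > 0}"
  define N where "N = {a \<in> A. rat_of a < 0}"
  have "A = P \<union> N" by (auto simp: P_def N_def) (metis linorder_neqE rat_of_nonzero)
  then have cA: "card A \<le> card P + card N" by (metis card_Un_le)
  have finPN: "finite P" "finite N" using fin by (auto simp: P_def N_def)
  have cA0: "card A > 0" using fin ne by (simp add: card_gt_0_iff)
  show thesis
  proof (cases "card N \<le> card P")
    case True
    have "P \<noteq> {}" using True cA cA0 by auto
    moreover have "(\<lambda>b. b + 0) ` P \<subseteq> A" "P + P \<subseteq> A + A"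
      by (auto simp: P_def intro!: set_plus_mono2 del: subsetI)
    ultimately show ?thesis using that[of P 0] finPN True cA by (auto simp: P_def)
  next
    case False
    \<comment> \<open>If most elements are negative they are all multiplied by \<open>-1\<close>,
      which is \<open>g\<close> and has order two; the signs cancel in the sumset.\<close>
    define g where "g = nz (- 1)"
    have rg: "rat_of g = - 1" by (simp add: g_def)
    have gg: "g + g = 0" by (rule rat_of_inject[THEN iffD1]) (simp add: rat_of_simps rg)
    let ?B = "(\<lambda>a. a + g) ` N"
    have "card ?B = card N" by (rule card_translate)
    moreover have "?B \<noteq> {}" using False by auto
    moreover have "?B \<subseteq> {a. rat_of a > 0}" by (auto simp: N_def rat_of_simps rg)
    moreover have "(\<lambda>b. b + g) ` ?B \<subseteq> A" by (auto simp: N_def add.assoc gg)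
    moreover have "?B + ?B \<subseteq> A + A"
    proof
      fix y assume "y \<in> ?B + ?B"
      then obtain a b where ab: "a \<in> N" "b \<in> N" "y = (a + g) + (b + g)" by (auto elim!: set_plus_elim)
      then have "y = a + b + (g + g)" by (simp only: ac_simps)
      then have "y = a + b" by (simp add: gg)
      then show "y \<in> A + A" using ab(1,2) by (auto simp: N_def)
    qed
    ultimately show ?thesis using that[of ?B g] finPN False cA by auto
  qed
qed

text \<open>The growth theorem is applied to \<open>B + B\<close> with all prime valuations as
  homomorphisms and the capacity as \<open>\<mu>\<close>. With \<open>n = card B\<close> it gives
  \<open>n powr (1 + c) \<le> K * n * \<mu> powr c\<close>; then \<open>n\<close> cancels and the
  power \<open>1 / c\<close> is taken.\<close>

lemma card_le_capacity:
  fixes A :: "nzrat set"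
  assumes q: "q \<ge> 2" and d: "d \<ge> 1" and c: "0 < c" "c \<le> 1 / 2"
    and \<theta>c: "(1 / (6 * real ((d + 1)\<^sup>2) * real (q\<^sup>2))) powr (- c) \<le> 1 + 1 / 2 ^ 29"
    and B: "finite B" "B \<noteq> {}" "B \<subseteq> {a. rat_of a > 0}"
    and K: "real (card (B + B)) \<le> K * real (card B)"
  shows "real (card B) \<le> K powr (1 / c) * capacity q d B"
proof -
  let ?\<mu> = "capacity q d B" and ?n = "real (card B)"
  define V where "V = (\<lambda>p a. rval p (rat_of a)) ` {p. prime p}"
  have \<mu>: "?\<mu> \<ge> 1" using q B by (intro capacity_ge_one) auto
  have n: "?n > 0" using B by (simp add: card_gt_0_iff)
  have "(?n powr (1 + c) * ?\<mu> powr (- c)) * (?n powr (1 + c) * ?\<mu> powr (- c)) \<le> (real (card (B + B)))\<^sup>2"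
  proof (rule card_sumset_ge[where V = V and U = "{a. rat_of a > 0}" and
        \<theta> = "1 / (6 * real ((d + 1)\<^sup>2) * real (q\<^sup>2))"])
    show "v (x + y) = v x + v y" if "v \<in> V" for v x y
      using that by (auto simp: V_def rat_of_simps rval_mult)
    show "x = y" if "x \<in> {a. rat_of a > 0}" "y \<in> {a. rat_of a > 0}" "\<And>v. v \<in> V \<Longrightarrow> v x = v y" for x y
      using rval_separates[of "rat_of x" "rat_of y"] that by (auto simp: V_def rat_of_inject)
    show "1 \<le> capacity q d A" if "finite A" "A \<noteq> {}" for A
      using that q by (intro capacity_ge_one) auto
    show "capacity q d A \<le> capacity q d A'" if "finite A'" "A \<subseteq> A'" for A A'
      using that q by (intro capacity_mono) auto
    show "1 / (6 * real ((d + 1)\<^sup>2) * real (q\<^sup>2)) * (\<Sum>j\<in>v ` A. capacity q d {x \<in> A. v x = j}) \<le> capacity q d A"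
      if "v \<in> V" "finite A" for v A
      using that capacity_split[OF q d _ that(2)] by (auto simp: V_def)
    show "0 < 1 / (6 * real ((d + 1)\<^sup>2) * real (q\<^sup>2))" using q by simp
  qed (use c \<theta>c B in auto)
  then have "?n powr (1 + c) * ?\<mu> powr (- c) \<le> real (card (B + B))"
  proof -
    assume "(?n powr (1 + c) * ?\<mu> powr (- c)) * (?n powr (1 + c) * ?\<mu> powr (- c)) \<le> (real (card (B + B)))\<^sup>2"
    then have "(?n powr (1 + c) * ?\<mu> powr (- c))\<^sup>2 \<le> (real (card (B + B)))\<^sup>2"
      by (simp only: power2_eq_square)
    then show ?thesis by (rule power2_le_imp_le) simp
  qed
  also have "\<dots> \<le> K * ?n" by (rule K)
  finally have "?n powr (1 + c) * ?\<mu> powr (- c) \<le> K * ?n" .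
  moreover have "?n powr (1 + c) * ?\<mu> powr (- c) = (?n powr c * ?n) / ?\<mu> powr c"
    using n by (simp add: powr_add powr_minus divide_inverse)
  moreover have "?\<mu> powr c > 0" using \<mu> by simp
  ultimately have "?n powr c * ?n \<le> (K * ?n) * ?\<mu> powr c" by (simp only: pos_divide_le_eq)
  then have "?n powr c * ?n \<le> (K * ?\<mu> powr c) * ?n" by (simp only: ac_simps)
  then have le: "?n powr c \<le> K * ?\<mu> powr c" using n by (simp only: mult_le_cancel_right_pos)
  have "0 < ?n powr c" using n by simp
  then have "0 < K * ?\<mu> powr c" using le by linarith
  then have K0: "K > 0" using \<mu> by (simp add: zero_less_mult_iff)
  have "?n = (?n powr c) powr (1 / c)" using c n by (simp add: powr_powr)
  also have "\<dots> \<le> (K * ?\<mu> powr c) powr (1 / c)" using le c n by (intro powr_mono2) auto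
  also have "\<dots> = K powr (1 / c) * ?\<mu>" using K0 \<mu> c by (simp add: powr_mult powr_powr)
  finally show ?thesis .
qed

text \<open>Double counting over dilates: \<open>a\<close> in \<open>A'\<close> and \<open>b\<close>
  in \<open>B\<close> determine \<open>x = a - b\<close>, so the weights of the sets
  \<open>S x\<close> sum to \<open>card A' * sum w B\<close>. There are at most
  \<open>K\<^sup>2 * card A\<close> dilates, each of weight at most
  \<open>K\<^sup>2 * card A powr (2 / q)\<close>, while \<open>sum w B\<close> is at least
  \<open>card A\<close> up to a power of \<open>2 * K\<close> and a constant.\<close>

lemma card_graph_le:
  fixes A A' :: "nzrat set"
  assumes q: "q \<ge> 2" and d: "d \<ge> 1" and c: "0 < c" "c \<le> 1 / 2"
    and \<theta>c: "(1 / (6 * real ((d + 1)\<^sup>2) * real (q\<^sup>2))) powr (- c) \<le> 1 + 1 / 2 ^ 29"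
    and A: "finite A" "A \<noteq> {}" and K: "real (card (A + A)) \<le> K * real (card A)"
    and \<phi>: "degree \<phi> = d" "poly \<phi> 0 \<noteq> 0" and sub: "A' \<subseteq> A"
    and A': "\<And>a. a \<in> A' \<Longrightarrow> poly \<phi> (rat_of a) \<noteq> 0 \<and> nz (poly \<phi> (rat_of a)) \<in> A"
  shows "real (card A') \<le> 4 * K ^ 4 * (2 * K) powr (1 / c) * real (card A) powr (2 / real q)"
proof (cases "A' = {}")
  case True
  have "K ^ 4 \<ge> 0" by simp
  then show ?thesis using True by simp
next
  case ne': False
  let ?n = "real (card A)"
  have n: "?n > 0" using A by (simp add: card_gt_0_iff)
  have finA': "finite A'" using sub A finite_subset by blast
  have "?n \<le> real (card (A + A))" using card_le_card_plus[OF A(1) A(1) A(2)] by simp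
  then have K1: "K \<ge> 1" using K n by (metis mult_le_cancel_right1 not_less order_trans)
  obtain B g where B: "finite B" "B \<noteq> {}" "B \<subseteq> {a. rat_of a > 0}" "card A \<le> 2 * card B"
    "(\<lambda>b. b + g) ` B \<subseteq> A" "B + B \<subseteq> A + A"
    using positive_part[OF A] by blast
  have "real (card (B + B)) \<le> real (card (A + A))"
    using card_mono[OF finite_set_plus[OF A(1) A(1)] B(6)] by simp
  also have "\<dots> \<le> K * ?n" by (rule K)
  also have "\<dots> \<le> K * (2 * real (card B))" using B(4) K1 by (intro mult_left_mono) auto
  finally have "real (card (B + B)) \<le> (2 * K) * real (card B)" by simp
  from card_le_capacity[OF q d c \<theta>c B(1-3) this]
  have cap: "real (card B) \<le> (2 * K) powr (1 / c) * capacity q d B" .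
  have \<mu>: "capacity q d B \<ge> 1" using q B by (intro capacity_ge_one) auto
  obtain w where w: "admissible q d B w" and w2: "capacity q d B - capacity q d B / 2 < sum w B"
    using capacity_approx[of q "capacity q d B / 2" d B] q \<mu> by auto
  have W2: "capacity q d B \<le> 2 * sum w B" using w2 by simp
  define X where "X = (\<lambda>(a, b). a - b) ` (A' \<times> B)"
  have finX: "finite X" and neX: "X \<noteq> {}" using finA' B ne' by (auto simp: X_def)
  define S where "S = (\<lambda>x. {b \<in> B. b + x \<in> A'})"
  have cardX: "real (card X) \<le> K\<^sup>2 * ?n"
  proof -
    let ?D = "(\<lambda>(a, b). a - b) ` (A \<times> A)"
    \<comment> \<open>A translate of \<open>B\<close> lies in \<open>A\<close>, so these differences
      lie in a translate of the difference set of \<open>A\<close>, which Ruzsa's inequality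
      bounds.\<close>
    have "X \<subseteq> (\<lambda>y. y + g) ` ?D"
    proof
      fix x assume "x \<in> X"
      then obtain a b where ab: "a \<in> A'" "b \<in> B" "x = a - b" by (auto simp: X_def)
      then have "x = (a - (b + g)) + g" by (simp add: algebra_simps)
      moreover have "a - (b + g) \<in> ?D" using ab sub B(5) by (intro image_eqI[of _ _ "(a, b + g)"]) auto
      ultimately show "x \<in> (\<lambda>y. y + g) ` ?D" by blast
    qed
    then have "card X \<le> card ((\<lambda>y. y + g) ` ?D)" using A by (intro card_mono) auto
    then have "card X \<le> card ?D" by (simp only: card_translate)
    then have "card X * card A \<le> card ?D * card A" by simp
    also have "\<dots> \<le> (card (A + A))\<^sup>2" by (rule Ruzsa_difference_le[OF A(1)])
    finally have "real (card X) * ?n \<le> (real (card (A + A)))\<^sup>2"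
      by (metis of_nat_le_iff of_nat_mult of_nat_power)
    also have "\<dots> \<le> (K * ?n)\<^sup>2" using K by (intro power_mono) auto
    also have "\<dots> = (K\<^sup>2 * ?n) * ?n" by (simp add: power2_eq_square)
    finally show ?thesis using n by (simp only: mult_le_cancel_right_pos)
  qed
  have W: "sum w (S x) \<le> K\<^sup>2 * ?n powr (2 / real q)" if "x \<in> X" for x
  proof -
    \<comment> \<open>The dilated polynomial has the same degree and the same value at
      \<open>0\<close>, so the weights \<open>w\<close>, chosen before \<open>x\<close>, control its
      graph too.\<close>
    define \<psi> where "\<psi> = pcompose \<phi> [:0, rat_of x:]"
    have \<psi>: "poly \<psi> (rat_of b) = poly \<phi> (rat_of (b + x))" for b
      by (simp add: \<psi>_def poly_pcompose rat_of_simps)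
    let ?f = "graph_alg \<psi> w (S x)"
    have en: "energy q ?f \<le> (sum w (S x)) ^ q"
    proof (rule admissibleD(3)[OF w])
      show "degree \<psi> = d" using \<phi> by (simp add: \<psi>_def degree_pcompose)
      show "poly \<psi> 0 \<noteq> 0" using \<phi> by (simp add: \<psi>_def poly_pcompose)
      show "S x \<subseteq> B" by (auto simp: S_def)
      show "poly \<psi> (rat_of b) \<noteq> 0" if "b \<in> S x" for b
        using A'[of "b + x"] that by (simp add: \<psi> S_def)
    qed
    have "fst h + x \<in> A \<and> snd h \<in> A" if "h \<in> keys ?f" for h
    proof -
      obtain b where b: "b \<in> S x" "h = graph_point \<psi> b"
        using subsetD[OF keys_graph_alg \<open>h \<in> keys ?f\<close>] by blast
      then show ?thesis using A'[of "b + x"] sub by (auto simp: graph_point_def \<psi> S_def)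
    qed
    from keys_power_fold_sumset[OF this]
    obtain z where z: "keys (?f ^ q) \<subseteq> (\<lambda>s. s - z) ` fold_sumset q A \<times> fold_sumset q A" by blast
    have fs: "finite (fold_sumset q A)" using finite_fold_sumset[OF A(1)] .
    \<comment> \<open>Admissibility bounds the energy above, its support bounds it below, and
      Pluennecke's inequality bounds the support.\<close>
    have "mass ?f ^ (2 * q) \<le> real (card ((\<lambda>s. s - z) ` fold_sumset q A \<times> fold_sumset q A)) * energy q ?f"
      using fs by (intro mass_le_energy[OF _ z]) auto
    also have "\<dots> \<le> (K ^ q * ?n)\<^sup>2 * (sum w (S x)) ^ q"
    proof (rule mult_mono[OF _ en])
      have "card ((\<lambda>s. s - z) ` fold_sumset q A \<times> fold_sumset q A) \<le> card (fold_sumset q A) * card (fold_sumset q A)"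
        unfolding card_cartesian_product using card_image_le[OF fs] by (rule mult_le_mono1)
      then have "real (card ((\<lambda>s. s - z) ` fold_sumset q A \<times> fold_sumset q A)) \<le> (real (card (fold_sumset q A)))\<^sup>2"
        by (metis of_nat_le_iff of_nat_mult power2_eq_square)
      also have "\<dots> \<le> (K ^ q * ?n)\<^sup>2"
        using card_fold_sumset_le[OF A(1) K A(2)] by (intro power_mono) auto
      finally show "real (card ((\<lambda>s. s - z) ` fold_sumset q A \<times> fold_sumset q A)) \<le> (K ^ q * ?n)\<^sup>2" .
    qed (auto simp: energy_nonneg)
    finally have "sum w (S x) ^ (2 * q) \<le> (K ^ q * ?n)\<^sup>2 * (sum w (S x)) ^ q"
      by (simp only: mass_graph_alg)
    then show ?thesis
      using q K1 n admissibleD(1)[OF w] by (intro root_le_powr) (auto intro: sum_nonneg)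
  qed
  have "real (card A') * sum w B = (\<Sum>b\<in>B. \<Sum>a\<in>A'. w b)" by (simp add: sum_distrib_left)
  also have "\<dots> = (\<Sum>b\<in>B. \<Sum>x | x \<in> X \<and> b + x \<in> A'. w b)"
  proof (rule sum.cong[OF refl])
    fix b assume b: "b \<in> B"
    have "bij_betw (\<lambda>a. a - b) A' {x \<in> X. b + x \<in> A'}"
    proof (rule bij_betwI[where g = "\<lambda>x. b + x"])
      show "(\<lambda>a. a - b) \<in> A' \<rightarrow> {x \<in> X. b + x \<in> A'}"
        using b by (auto simp: X_def)
    qed auto
    from bij_betw_same_card[OF this] show "(\<Sum>a\<in>A'. w b) = (\<Sum>x | x \<in> X \<and> b + x \<in> A'. w b)" by simp
  qed
  also have "\<dots> = (\<Sum>x\<in>X. sum w (S x))"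
    unfolding S_def using finX B(1) by (rule sum.swap_restrict[symmetric])
  also have "\<dots> \<le> (\<Sum>x\<in>X. K\<^sup>2 * ?n powr (2 / real q))" using W by (rule sum_mono)
  also have "\<dots> = real (card X) * (K\<^sup>2 * ?n powr (2 / real q))" by simp
  also have "\<dots> \<le> (K\<^sup>2 * ?n) * (K\<^sup>2 * ?n powr (2 / real q))"
    using cardX by (intro mult_right_mono) auto
  also have "\<dots> = K ^ 4 * ?n powr (2 / real q) * ?n" by (simp add: power4_eq_xxxx power2_eq_square)
  finally have main: "real (card A') * sum w B \<le> K ^ 4 * ?n powr (2 / real q) * ?n" .
  have "?n \<le> 2 * real (card B)" using B(4) by linarith
  also have "\<dots> \<le> 2 * ((2 * K) powr (1 / c) * (2 * sum w B))"
    using cap W2 by (meson mult_left_mono order_trans powr_ge_zero zero_le_numeral)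
  finally have nB: "?n \<le> 4 * (2 * K) powr (1 / c) * sum w B" by simp
  have "real (card A') * ?n \<le> real (card A') * (4 * (2 * K) powr (1 / c) * sum w B)"
    using nB by (intro mult_left_mono) auto
  also have "\<dots> = 4 * (2 * K) powr (1 / c) * (real (card A') * sum w B)" by simp
  also have "\<dots> \<le> 4 * (2 * K) powr (1 / c) * (K ^ 4 * ?n powr (2 / real q) * ?n)"
    using main by (intro mult_left_mono) auto
  also have "\<dots> = (4 * K ^ 4 * (2 * K) powr (1 / c) * ?n powr (2 / real q)) * ?n" by simp
  finally show ?thesis using n by (simp only: mult_le_cancel_right_pos)
qed

section \<open>Return to finite sets of rationals\<close>

lemma card_nz_plus_le:
  fixes A :: "rat set"
  assumes "finite A"
  shows "card (nz ` (A - {0}) + nz ` (A - {0})) \<le> card (A * A)"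
proof -
  have "rat_of ` (nz ` (A - {0}) + nz ` (A - {0})) \<subseteq> A * A"
  proof clarify
    fix y assume "y \<in> nz ` (A - {0}) + nz ` (A - {0})"
    then obtain a b where "a \<in> A" "a \<noteq> 0" "b \<in> A" "b \<noteq> 0" "y = nz a + nz b"
      by (auto elim!: set_plus_elim)
    then show "rat_of y \<in> A * A" by (auto simp: rat_of_simps)
  qed
  moreover have "inj_on rat_of (nz ` (A - {0}) + nz ` (A - {0}))"
    by (auto simp: inj_on_def rat_of_inject)
  ultimately show ?thesis using assms by (intro card_inj_on_le) (auto intro: finite_set_times)
qed

lemma exponent_exists:
  fixes C e :: real
  assumes "C > 1" "e > 0"
  obtains c where "0 < c" "c \<le> 1 / 2" "(1 / C) powr (- c) \<le> 1 + e"
proof -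
  define c where "c = min (1 / 2) (ln (1 + e) / ln C)"
  have "c > 0" using assms by (simp add: c_def)
  moreover have "c * ln C \<le> (ln (1 + e) / ln C) * ln C"
    using assms by (intro mult_right_mono) (auto simp: c_def)
  then have "c * ln C \<le> ln (1 + e)" using assms by simp
  then have "exp (c * ln C) \<le> exp (ln (1 + e))" by simp
  then have "C powr c \<le> 1 + e" using assms by (simp add: powr_def)
  then have "(1 / C) powr (- c) \<le> 1 + e"
    using assms by (simp add: powr_minus powr_divide)
  moreover have "c \<le> 1 / 2" unfolding c_def by (rule min.cobounded1)
  ultimately show ?thesis using that by blast
qed

theorem theorem2p2:
  fixes d :: nat and \<epsilon> :: real
  assumes "d \<ge> 1" and "\<epsilon> > 0"
  shows "\<exists>C > 0. \<exists>B > 0. \<forall>(A :: rat set) (K :: real) (\<phi> :: rat poly).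
           finite A \<longrightarrow> K \<ge> 1 \<longrightarrow> real (card (A * A)) \<le> K * real (card A) \<longrightarrow>
           degree \<phi> = d \<longrightarrow> poly \<phi> 0 \<noteq> 0 \<longrightarrow>
           real (card {(a1, a2) \<in> A \<times> A. a1 = poly \<phi> a2})
             \<le> B * K powr C * real (card A) powr \<epsilon>"
proof -
  \<comment> \<open>Large enough for \<open>2 / q \<le> \<epsilon>\<close>; the added
    \<open>2\<close> gives \<open>q \<ge> 2\<close>.\<close>
  define q where "q = nat \<lceil>2 / \<epsilon>\<rceil> + 2"
  have q: "q \<ge> 2" by (simp add: q_def)
  have "2 / \<epsilon> \<le> real q" by (simp add: q_def) linarith
  then have q\<epsilon>: "2 / real q \<le> \<epsilon>" using assms(2) q by (simp add: field_simps)
  have "1 \<le> (d + 1)\<^sup>2" "1 \<le> q\<^sup>2" using q by simp_all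
  then have "1 * 1 \<le> real ((d + 1)\<^sup>2) * real (q\<^sup>2)" by (intro mult_mono) linarith+
  then have "6 * real ((d + 1)\<^sup>2) * real (q\<^sup>2) > 1" by simp
  \<comment> \<open>The tolerance \<open>1 / 2 ^ 29\<close> is the growth factor built into
    \<open>gain\<close>, against which a splitting may cost at most
    \<open>\<theta> powr (- c)\<close>.\<close>
  then obtain c where c: "0 < c" "c \<le> 1 / 2"
    and \<theta>c: "(1 / (6 * real ((d + 1)\<^sup>2) * real (q\<^sup>2))) powr (- c) \<le> 1 + 1 / 2 ^ 29"
    by (rule exponent_exists[where e = "1 / 2 ^ 29"]) auto
  \<comment> \<open>The final bound has the factor
    \<open>4 * (2 * K) ^ 4 * (4 * K) powr (1 / c)\<close>, the doubling constant being
    \<open>2 * K\<close> once \<open>0\<close> is removed; this yields \<open>64\<close>, the power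
    of \<open>4\<close> and the exponent \<open>C\<close>.\<close>
  define C where "C = 4 + 1 / c"
  define B where "B = 64 * 4 powr (1 / c) + real d + 1"
  have "C > 0" using c by (simp add: C_def add_pos_pos)
  moreover have "B > 0" by (simp add: B_def add_nonneg_pos)
  moreover have "real (card {(a1, a2) \<in> A \<times> A. a1 = poly \<phi> a2}) \<le> B * K powr C * real (card A) powr \<epsilon>"
    if A: "finite A" and K: "K \<ge> 1" and KA: "real (card (A * A)) \<le> K * real (card A)"
      and \<phi>: "degree \<phi> = d" "poly \<phi> 0 \<noteq> 0" for A :: "rat set" and K \<phi>
  proof (cases "A = {}")
    case False
    let ?n = "real (card A)"
    have n: "?n \<ge> 1" using A False by (simp add: Suc_leI card_gt_0_iff)
    define A0 where "A0 = nz ` (A - {0})"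
    \<comment> \<open>The pairs not counted by \<open>A'\<close> have second entry \<open>0\<close>
      or a root of \<open>\<phi>\<close>, so there are at most \<open>1 + d\<close> of them.\<close>
    define A' where "A' = {a \<in> A0. poly \<phi> (rat_of a) \<noteq> 0 \<and> nz (poly \<phi> (rat_of a)) \<in> A0}"
    have finA0: "finite A0" "finite A'" using A by (auto simp: A0_def A'_def)
    have cA0: "card A0 = card (A - {0})"
      unfolding A0_def by (rule card_image) (auto simp: inj_on_def nz_inject)
    have "\<phi> \<noteq> 0" using \<phi> by auto
    then have roots: "finite {x. poly \<phi> x = 0}" "card {x. poly \<phi> x = 0} \<le> d"
      using \<phi> poly_roots_finite[of \<phi>] card_poly_roots_bound[of \<phi>] by auto
    have "{(a1, a2) \<in> A \<times> A. a1 = poly \<phi> a2} \<subseteq>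
        (\<lambda>x. (poly \<phi> x, x)) ` ({0} \<union> {x. poly \<phi> x = 0} \<union> rat_of ` A')"
    proof clarify
      fix x assume x: "poly \<phi> x \<in> A" "x \<in> A"
      show "(poly \<phi> x, x) \<in> (\<lambda>x. (poly \<phi> x, x)) ` ({0} \<union> {x. poly \<phi> x = 0} \<union> rat_of ` A')"
      proof (cases "x = 0 \<or> poly \<phi> x = 0")
        case False
        then have "nz x \<in> A'" using x by (auto simp: A'_def A0_def)
        then have "x \<in> rat_of ` A'" using False by (intro image_eqI[of _ _ "nz x"]) auto
        then show ?thesis by blast
      qed auto
    qed
    then have "card {(a1, a2) \<in> A \<times> A. a1 = poly \<phi> a2} \<le>
        card ({0} \<union> {x. poly \<phi> x = 0} \<union> rat_of ` A')"
      using roots(1) finA0 by (intro surj_card_le) auto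
    also have "\<dots> \<le> card {0 :: rat} + card {x. poly \<phi> x = 0} + card (rat_of ` A')"
      by (meson add_le_mono card_Un_le le_refl order_trans)
    also have "\<dots> \<le> 1 + d + card A'"
      using roots(2) card_image_le[OF finA0(2), of rat_of] by (intro add_mono) auto
    finally have count: "real (card {(a1, a2) \<in> A \<times> A. a1 = poly \<phi> a2}) \<le> 1 + real d + real (card A')"
      by linarith
    have KC: "1 \<le> K powr C" and n\<epsilon>: "1 \<le> ?n powr \<epsilon>"
      using K n c assms(2) by (auto simp: C_def intro!: ge_one_powr_ge_zero)
    have "real (card A') \<le> 64 * 4 powr (1 / c) * (K powr C * ?n powr \<epsilon>)"
    proof (cases "A0 = {}")
      case True
      then show ?thesis by (simp add: A'_def)
    next
      case A0ne: False
      have c0: "card A0 \<ge> 1" using A0ne finA0 by (simp add: Suc_leI card_gt_0_iff)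
      \<comment> \<open>Removing \<open>0\<close> at most halves the size, as \<open>A0\<close> is
        nonempty; this is what doubles \<open>K\<close>.\<close>
      have "card A \<le> card A0 + 1" unfolding cA0 using A by (simp add: card_Diff_singleton_if) linarith
      then have nA0: "?n \<le> 2 * real (card A0)" using c0 by linarith
      have "real (card (A0 + A0)) \<le> real (card (A * A))"
        unfolding A0_def using card_nz_plus_le[OF A] by simp
      also have "\<dots> \<le> K * ?n" by (rule KA)
      also have "\<dots> \<le> K * (2 * real (card A0))" using nA0 K by (intro mult_left_mono) auto
      finally have "real (card (A0 + A0)) \<le> (2 * K) * real (card A0)" by simp
      then have "real (card A') \<le>
          4 * (2 * K) ^ 4 * (2 * (2 * K)) powr (1 / c) * real (card A0) powr (2 / real q)"
        by (intro card_graph_le[OF q assms(1) c \<theta>c finA0(1) A0ne _ \<phi>]) (auto simp: A'_def)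
      also have "\<dots> = 64 * 4 powr (1 / c) * (K powr C * real (card A0) powr (2 / real q))"
        using K by (simp add: C_def powr_add powr_mult power_mult_distrib)
      also have "\<dots> \<le> 64 * 4 powr (1 / c) * (K powr C * ?n powr \<epsilon>)"
      proof (intro mult_left_mono)
        have "real (card A0) powr (2 / real q) \<le> ?n powr (2 / real q)"
          using A by (intro powr_mono2) (auto simp: cA0 intro!: card_mono)
        also have "\<dots> \<le> ?n powr \<epsilon>" using q\<epsilon> n by (intro powr_mono) auto
        finally show "real (card A0) powr (2 / real q) \<le> ?n powr \<epsilon>" .
      qed auto
      finally show ?thesis .
    qed
    moreover have "1 + real d \<le> (1 + real d) * (K powr C * ?n powr \<epsilon>)"
      using mult_mono[OF KC n\<epsilon>] mult_left_mono[of 1 "K powr C * ?n powr \<epsilon>" "1 + real d"] by simp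
    ultimately show ?thesis using count by (simp add: B_def algebra_simps)
  qed simp
  ultimately show ?thesis by blast
qed

end
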